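(* Let $\mathcal C$ be the free $3$-step nilpotent group of rank $2$ on $x,y$, with $S=\{x^{\pm1},y^{\pm1}\}$, and let $\gamma_u$ ($u\in\mathbb S^1$) be the geodesic rays described in the context. Then the classes $[b_{\gamma_u}]$, $u\in\mathbb S^1$, are pairwise distinct in the reduced boundary $\partial^r(\mathcal C,d_S)$. Moreover, for every $u\in\mathbb S^1$, the stabilizer of $[b_{\gamma_u}]$ for the action of $\mathcal C$ on $\partial^r(\mathcal C,d_S)$ satisfies $$\mathrm{Stab}_{\mathcal C}([b_{\gamma_u}])\le\{g\in\mathcal C:\hat g\in\mathbb R u\}$$ (the right-hand side being $[\mathcal C,\mathcal C]$ when $u$ has irrational slope).
   Context: Horofunctions. For a group $G$ with finite symmetric generating set $S$ and word metric $d_S$, put $\varphi_g(\ast)=d_S(g,\ast)-d_S(g,e)$ and $\iota(g)=\varphi_g$, in the space of functions $G\to\mathbb R$ with pointwise convergence. The horoboundary is $\partial(G,d_S)=\overline{\iota(G)}\setminus\iota(G)$. For a geodesic ray $\gamma=(\gamma_n)_{n\ge0}$, the Busemann point is $b_\gamma=\lim_n\varphi_{\gamma_n}\in\partial(G,d_S)$. The group acts by $(g\cdot\varphi)(h)=\varphi(g^{-1}h)-\varphi(g^{-1})$. The reduced horoboundary $\partial^r(G,d_S)$ is the quotient of $\partial(G,d_S)$ identifying two horofunctions whose difference is bounded; the class of $\varphi$ is $[\varphi]$, and $G$ acts on $\partial^r(G,d_S)$. The abelianization map of $\mathcal C$ is $\mathcal C\to\mathbb Z^2\subset\mathbb R^2$,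 $g\mapsto\hat g$, with $\hat x=(1,0)$, $\hat y=(0,1)$. The rays $\gamma_u$. For $u\in\mathbb S^1$, $\gamma_u=(\gamma_{u,n})_{n\ge0}$ is the path in the Cayley graph of $(\mathcal C,S)$ with $\gamma_{u,0}=e$ that lifts the following infinite lattice path $\hat\gamma_u$ in $\mathbb Z^2$ starting at the origin. If $u\in\{(\pm1,0),(0,\pm1)\}$, $\hat\gamma_u$ is the straight path along the ray $\mathbb R^+u$. Otherwise let $Q$ be the closed quadrant containing $u$. Divide the unit squares of the integer grid contained in $Q$ into two categories according to the side of the ray $\mathbb R^+u$ on which their center lies; $\hat\gamma_u$ is the lattice path from the origin in $Q$, using only the two unit steps pointing into $Q$, such that the squares of one category all lie on one side of the path and the squares of the other category on the other side. Squares whose center lies exactly on the ray (which happens only when $u$ is a positive multiple of $(a,b)$ with $a,b$ odd integers) are assigned alternately to the two categories, in order of distance from the origin. The path $\hat\gamma_u$ is geodesic in $\mathbb Z^2$, so $\gamma_u$ is geodesic in $\mathcal C$. *)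

theory Defs
  imports "HOL-Analysis.Analysis" "HOL-Algebra.Algebra"
begin

section \<open>Free groups and free nilpotent groups\<close>

text \<open>The letter \<open>(a, True)\<close> stands for the generator \<open>a\<close> and \<open>(a, False)\<close> for its inverse.\<close>

type_synonym 'a word = "('a \<times> bool) list"

definition inv_letter :: "'a \<times> bool \<Rightarrow> 'a \<times> bool" where
  "inv_letter l = (fst l, \<not> snd l)"

fun push :: "'a \<times> bool \<Rightarrow> 'a word \<Rightarrow> 'a word" where
  "push l [] = [l]"
| "push l (m # w) = (if m = inv_letter l then w else l # m # w)"

definition reduce :: "'a word \<Rightarrow> 'a word" where
  "reduce w = foldr push w []"

definition free_group :: "'a word monoid" where
  "free_group = \<lparr>carrier = {w. reduce w = w}, mult = (\<lambda>u v. reduce (u @ v)), one = []\<rparr>"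

text \<open>The numbering is shifted: \<open>lower_central G n\<close> is $\gamma_{n+1}(G)$, so that \<open>G\<close> is
  \<open>n\<close>-step nilpotent iff \<open>lower_central G n\<close> is trivial.\<close>

primrec lower_central :: "('a, 'b) monoid_scheme \<Rightarrow> nat \<Rightarrow> 'a set" where
  "lower_central G 0 = carrier G"
| "lower_central G (Suc n) = generate G
     (\<Union>g \<in> lower_central G n. \<Union>h \<in> carrier G.
        {g \<otimes>\<^bsub>G\<^esub> h \<otimes>\<^bsub>G\<^esub> (inv\<^bsub>G\<^esub> g) \<otimes>\<^bsub>G\<^esub> (inv\<^bsub>G\<^esub> h)})"

definition free_nilpotent :: "nat \<Rightarrow> 'a word set monoid" where
  "free_nilpotent n = free_group Mod lower_central free_group n"

definition free_nilpotent_gen :: "nat \<Rightarrow> 'a \<Rightarrow> 'a word set" where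
  "free_nilpotent_gen n a = lower_central free_group n #>\<^bsub>free_group\<^esub> [(a, True)]"


section \<open>Word metrics and horofunctions\<close>

definition word_length :: "('a, 'b) monoid_scheme \<Rightarrow> 'a set \<Rightarrow> 'a \<Rightarrow> nat" where
  "word_length G S g =
     (LEAST n. \<exists>ws. length ws = n \<and> set ws \<subseteq> S \<and> foldr (\<otimes>\<^bsub>G\<^esub>) ws \<one>\<^bsub>G\<^esub> = g)"

definition word_dist :: "('a, 'b) monoid_scheme \<Rightarrow> 'a set \<Rightarrow> 'a \<Rightarrow> 'a \<Rightarrow> real" where
  "word_dist G S g h = real (word_length G S (inv\<^bsub>G\<^esub> g \<otimes>\<^bsub>G\<^esub> h))"

text \<open>Functions on \<open>G\<close> are represented by extensional functions on \<open>carrier G\<close>.\<close>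

definition dist_fun :: "('a, 'b) monoid_scheme \<Rightarrow> 'a set \<Rightarrow> 'a \<Rightarrow> 'a \<Rightarrow> real" where
  "dist_fun G S g = (\<lambda>h\<in>carrier G. word_dist G S g h - word_dist G S g \<one>\<^bsub>G\<^esub>)"

definition horoboundary :: "('a, 'b) monoid_scheme \<Rightarrow> 'a set \<Rightarrow> ('a \<Rightarrow> real) set" where
  "horoboundary G S =
     product_topology (\<lambda>_. euclideanreal) (carrier G) closure_of (dist_fun G S ` carrier G)
       - dist_fun G S ` carrier G"

definition busemann :: "('a, 'b) monoid_scheme \<Rightarrow> 'a set \<Rightarrow> (nat \<Rightarrow> 'a) \<Rightarrow> 'a \<Rightarrow> real" where
  "busemann G S \<gamma> = (\<lambda>h\<in>carrier G. lim (\<lambda>n. dist_fun G S (\<gamma> n) h))"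

definition horo_action :: "('a, 'b) monoid_scheme \<Rightarrow> 'a \<Rightarrow> ('a \<Rightarrow> real) \<Rightarrow> 'a \<Rightarrow> real" where
  "horo_action G g \<phi> =
     (\<lambda>h\<in>carrier G. \<phi> (inv\<^bsub>G\<^esub> g \<otimes>\<^bsub>G\<^esub> h) - \<phi> (inv\<^bsub>G\<^esub> g))"

definition bounded_diff ::
  "('a, 'b) monoid_scheme \<Rightarrow> 'a set \<Rightarrow> (('a \<Rightarrow> real) \<times> ('a \<Rightarrow> real)) set" where
  "bounded_diff G S = {(\<phi>, \<psi>). \<phi> \<in> horoboundary G S \<and> \<psi> \<in> horoboundary G S \<and>
     (\<exists>K. \<forall>h\<in>carrier G. \<bar>\<phi> h - \<psi> h\<bar> \<le> K)}"

definition reduced_horoboundary :: "('a, 'b) monoid_scheme \<Rightarrow> 'a set \<Rightarrow> ('a \<Rightarrow> real) set set" where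
  "reduced_horoboundary G S = horoboundary G S // bounded_diff G S"

definition horo_class ::
  "('a, 'b) monoid_scheme \<Rightarrow> 'a set \<Rightarrow> ('a \<Rightarrow> real) \<Rightarrow> ('a \<Rightarrow> real) set" where
  "horo_class G S \<phi> = bounded_diff G S `` {\<phi>}"

text \<open>Each \<open>horo_action G g\<close> permutes the horoboundary and preserves bounded difference, so the
  image of the class of \<open>\<phi>\<close> is the class of \<open>horo_action G g \<phi>\<close>.\<close>

definition reduced_action ::
  "('a, 'b) monoid_scheme \<Rightarrow> 'a \<Rightarrow> ('a \<Rightarrow> real) set \<Rightarrow> ('a \<Rightarrow> real) set" where
  "reduced_action G g A = horo_action G g ` A"


section \<open>The Cartan group\<close>

datatype gen = GX | GY

type_synonym cartan = "gen word set"

definition Cartan :: "cartan monoid" where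
  "Cartan = free_nilpotent 3"

definition cartan_x :: cartan where
  "cartan_x = free_nilpotent_gen 3 GX"

definition cartan_y :: cartan where
  "cartan_y = free_nilpotent_gen 3 GY"

definition cartan_gens :: "cartan set" where
  "cartan_gens = {cartan_x, inv\<^bsub>Cartan\<^esub> cartan_x, cartan_y, inv\<^bsub>Cartan\<^esub> cartan_y}"

fun letter_vec :: "gen \<times> bool \<Rightarrow> real \<times> real" where
  "letter_vec (GX, s) = (if s then 1 else -1, 0)"
| "letter_vec (GY, s) = (0, if s then 1 else -1)"

definition word_vec :: "gen word \<Rightarrow> real \<times> real" where
  "word_vec w = sum_list (map letter_vec w)"

text \<open>\<open>word_vec\<close> is constant on each coset, see \<open>cartan_ab_coset\<close> below.\<close>

definition cartan_ab :: "cartan \<Rightarrow> real \<times> real" where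
  "cartan_ab A = the_elem (word_vec ` A)"


section \<open>The rays\<close>

text \<open>The unit square \<open>(i, j)\<close> of the quadrant $[0,\infty)^2$ is $[i,i+1]\times[j,j+1]$.\<close>

definition square_centre :: "nat \<times> nat \<Rightarrow> real \<times> real" where
  "square_centre = (\<lambda>(i, j). (real i + 1/2, real j + 1/2))"

text \<open>Positive iff \<open>z\<close> lies on the left of the ray spanned by \<open>v\<close>, zero iff it lies on the line.\<close>

definition cross2 :: "real \<times> real \<Rightarrow> real \<times> real \<Rightarrow> real" where
  "cross2 v z = fst v * snd z - snd v * fst z"

definition monotone_lattice_path :: "(nat \<Rightarrow> nat \<times> nat) \<Rightarrow> bool" where
  "monotone_lattice_path p \<longleftrightarrow> p 0 = (0, 0) \<and>
     (\<forall>n. p (Suc n) = (Suc (fst (p n)), snd (p n)) \<or> p (Suc n) = (fst (p n), Suc (snd (p n))))"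

text \<open>A square lies on the left (upper) side of a monotone path iff the path traverses a horizontal
  edge vertically below it, and on the right (lower) side iff the path traverses a vertical edge
  horizontally to the left of it.\<close>

definition left_of_path :: "(nat \<Rightarrow> nat \<times> nat) \<Rightarrow> nat \<times> nat \<Rightarrow> bool" where
  "left_of_path p = (\<lambda>(i, j). \<exists>n h. h \<le> j \<and> p n = (i, h) \<and> p (Suc n) = (Suc i, h))"

definition right_of_path :: "(nat \<Rightarrow> nat \<times> nat) \<Rightarrow> nat \<times> nat \<Rightarrow> bool" where
  "right_of_path p = (\<lambda>(i, j). \<exists>n k. k \<le> i \<and> p n = (k, j) \<and> p (Suc n) = (k, Suc j))"

text \<open>\<open>U\<close> and its complement are the two categories of squares for the ray spanned by \<open>v\<close>. Either
  category may receive the first square centred on the ray: both values of \<open>c\<close> are allowed.\<close>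

definition square_division :: "real \<times> real \<Rightarrow> (nat \<times> nat) set \<Rightarrow> bool" where
  "square_division v U \<longleftrightarrow>
     (\<forall>q. cross2 v (square_centre q) > 0 \<longrightarrow> q \<in> U) \<and>
     (\<forall>q. cross2 v (square_centre q) < 0 \<longrightarrow> q \<notin> U) \<and>
     (\<exists>c. \<forall>q. cross2 v (square_centre q) = 0 \<longrightarrow>
        (q \<in> U \<longleftrightarrow> (even (card {r. cross2 v (square_centre r) = 0 \<and>
                                   norm (square_centre r) < norm (square_centre q)}) \<longleftrightarrow> c)))"

definition quadrant_path :: "real \<times> real \<Rightarrow> (nat \<Rightarrow> nat \<times> nat) \<Rightarrow> bool" where
  "quadrant_path v p \<longleftrightarrow> monotone_lattice_path p \<and>
     (\<exists>U. square_division v U \<and> (\<forall>q\<in>U. left_of_path p q) \<and> (\<forall>q. q \<notin> U \<longrightarrow> right_of_path p q))"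

text \<open>For \<open>u\<close> in another open quadrant, the path is obtained from the first quadrant by reflecting
  in the axes, which maps grid squares to grid squares and preserves the two divisions into sides.\<close>

definition lattice_ray :: "real \<times> real \<Rightarrow> (nat \<Rightarrow> real \<times> real) \<Rightarrow> bool" where
  "lattice_ray u P \<longleftrightarrow>
     (if fst u = 0 \<or> snd u = 0 then \<forall>n. P n = real n *\<^sub>R u
      else \<exists>p. quadrant_path (\<bar>fst u\<bar>, \<bar>snd u\<bar>) p \<and>
             (\<forall>n. P n = (sgn (fst u) * real (fst (p n)), sgn (snd u) * real (snd (p n)))))"

definition cartan_ray :: "real \<times> real \<Rightarrow> (nat \<Rightarrow> cartan) \<Rightarrow> bool" where
  "cartan_ray u \<gamma> \<longleftrightarrow> \<gamma> 0 = \<one>\<^bsub>Cartan\<^esub> \<and>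
     (\<forall>n. \<exists>s\<in>cartan_gens. \<gamma> (Suc n) = \<gamma> n \<otimes>\<^bsub>Cartan\<^esub> s) \<and>
     lattice_ray u (\<lambda>n. cartan_ab (\<gamma> n))"


section \<open>Well-definedness\<close>

lemma inv_letter_inv_letter [simp]: "inv_letter (inv_letter l) = l"
  by (simp add: inv_letter_def)

lemma reduce_Nil [simp]: "reduce [] = []"
  by (simp add: reduce_def)

lemma reduce_Cons: "reduce (l # w) = push l (reduce w)"
  by (simp add: reduce_def)

lemma reduce_tl: "reduce (l # w) = l # w \<Longrightarrow> reduce w = w"
proof -
  assume a: "reduce (l # w) = l # w"
  have len: "length (reduce v) \<le> length v" for v :: "'a word"
  proof (induction v)
    case (Cons m v)
    then show ?case by (cases "reduce v") (auto simp: reduce_Cons)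
  qed simp
  show "reduce w = w"
    using a len[of w] by (cases "reduce w") (auto simp: reduce_Cons split: if_splits)
qed

lemma push_push: "reduce w = w \<Longrightarrow> push (inv_letter l) (push l w) = w"
proof (cases w)
  case (Cons m v)
  assume w: "reduce w = w"
  have r: "reduce v = v" "push m v = m # v"
    using reduce_tl[of m v] w Cons by (auto simp: reduce_Cons)
  show ?thesis
    using r Cons by (cases v) (auto split: if_splits)
qed simp

lemma reduce_push: "reduce w = w \<Longrightarrow> reduce (push l w) = push l w"
proof (cases w)
  case (Cons m v)
  assume "reduce w = w"
  then show ?thesis using reduce_tl[of m v] Cons by (auto simp: reduce_Cons)
qed (simp add: reduce_Cons)

lemma reduce_reduce [simp]: "reduce (reduce w) = reduce w"
  by (induction w) (auto simp: reduce_Cons reduce_push)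

lemma reduce_append_right [simp]: "reduce (u @ reduce v) = reduce (u @ v)"
  by (induction u) (auto simp: reduce_Cons)

lemma reduce_push_append: "reduce (push l w @ v) = push l (reduce (w @ v))"
proof (cases w)
  case (Cons m w')
  show ?thesis
    using push_push[of "reduce (w' @ v)" "inv_letter l"] Cons by (auto simp: reduce_Cons)
qed (simp add: reduce_Cons)

lemma reduce_append_left [simp]: "reduce (reduce u @ v) = reduce (u @ v)"
  by (induction u) (auto simp: reduce_Cons reduce_push_append)

lemma reduce_inverse: "reduce (rev (map inv_letter w) @ w) = []"
proof (induction w)
  case (Cons l w)
  have "reduce (inv_letter l # l # w) = reduce w"
    using push_push[of "reduce w" l] by (simp add: reduce_Cons)
  then show ?case
    using Cons reduce_append_right[of "rev (map inv_letter w)" "inv_letter l # l # w"]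
    by (metis append.assoc append_Cons append_Nil list.simps(9) reduce_append_right rev.simps(2))
qed simp

lemma free_group_simps [simp]:
  "w \<in> carrier free_group \<longleftrightarrow> reduce w = w"
  "u \<otimes>\<^bsub>free_group\<^esub> v = reduce (u @ v)"
  "\<one>\<^bsub>free_group\<^esub> = []"
  by (auto simp: free_group_def)

lemma group_free_group: "group (free_group :: 'a word monoid)"
proof (rule groupI)
  fix w :: "'a word" assume "w \<in> carrier free_group"
  show "\<exists>v\<in>carrier free_group. v \<otimes>\<^bsub>free_group\<^esub> w = \<one>\<^bsub>free_group\<^esub>"
    by (rule bexI[of _ "reduce (rev (map inv_letter w))"]) (auto simp: reduce_inverse)
qed auto

lemma (in group) lower_central_normal: "lower_central G n \<lhd> G"
proof (induction n)
  case 0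
  show ?case by (simp add: normal_self)
next
  case (Suc n)
  interpret N: normal "lower_central G n" G by (rule Suc)
  show ?case
    unfolding lower_central.simps
  proof (rule normal_generateI)
    fix c k
    assume c: "c \<in> (\<Union>g \<in> lower_central G n. \<Union>h \<in> carrier G. {g \<otimes> h \<otimes> inv g \<otimes> inv h})"
      and k: "k \<in> carrier G"
    then obtain g h where gh: "g \<in> lower_central G n" "h \<in> carrier G"
      "c = g \<otimes> h \<otimes> inv g \<otimes> inv h" by auto
    have g: "g \<in> carrier G" using gh N.subset by auto
    have conj: "k \<otimes> (a \<otimes> b) \<otimes> inv k = (k \<otimes> a \<otimes> inv k) \<otimes> (k \<otimes> b \<otimes> inv k)"
      if "a \<in> carrier G" "b \<in> carrier G" for a b
    proof -
      have "inv k \<otimes> (k \<otimes> (b \<otimes> inv k)) = b \<otimes> inv k"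
        using that k by (simp flip: m_assoc)
      then show ?thesis using that k by (simp add: m_assoc)
    qed
    have conj_inv: "k \<otimes> inv a \<otimes> inv k = inv (k \<otimes> a \<otimes> inv k)" if "a \<in> carrier G" for a
      using that k by (simp add: inv_mult_group m_assoc)
    have E: "k \<otimes> c \<otimes> inv k = (k \<otimes> g \<otimes> inv k) \<otimes> (k \<otimes> h \<otimes> inv k) \<otimes>
        inv (k \<otimes> g \<otimes> inv k) \<otimes> inv (k \<otimes> h \<otimes> inv k)"
      unfolding gh(3) using g gh(2) k by (simp only: conj conj_inv m_closed inv_closed)
    have A: "k \<otimes> g \<otimes> inv k \<in> lower_central G n"
      using gh(1) k by (rule N.inv_op_closed2[rotated])
    have B: "k \<otimes> h \<otimes> inv k \<in> carrier G"
      using gh(2) k by (intro m_closed inv_closed)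
    show "k \<otimes> c \<otimes> inv k \<in>
        (\<Union>g \<in> lower_central G n. \<Union>h \<in> carrier G. {g \<otimes> h \<otimes> inv g \<otimes> inv h})"
      unfolding E by (rule UN_I[OF A UN_I[OF B singletonI]])
  next
    show "(\<Union>g \<in> lower_central G n. \<Union>h \<in> carrier G. {g \<otimes> h \<otimes> inv g \<otimes> inv h}) \<subseteq> carrier G"
      using N.subset by (intro UN_least) (auto simp: subset_iff)
  qed
qed

lemma normal_lower_central_free_group: "lower_central free_group n \<lhd> free_group"
  by (rule group.lower_central_normal[OF group_free_group])

lemma group_Cartan: "group Cartan"
  unfolding Cartan_def free_nilpotent_def
  by (rule normal.factorgroup_is_group[OF normal_lower_central_free_group])

lemma word_vec_simps [simp]:
  "word_vec [] = 0" "word_vec (l # w) = letter_vec l + word_vec w"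
  "word_vec (v @ w) = word_vec v + word_vec w"
  by (auto simp: word_vec_def)

lemma letter_vec_inv [simp]: "letter_vec (inv_letter l) = - letter_vec l"
  by (cases l; cases "fst l") (auto simp: inv_letter_def)

lemma word_vec_push [simp]: "word_vec (push l w) = letter_vec l + word_vec w"
  by (cases w) auto

lemma word_vec_reduce [simp]: "word_vec (reduce w) = word_vec w"
  by (induction w) (auto simp: reduce_Cons)

lemma word_vec_inv:
  assumes "w \<in> carrier free_group"
  shows "word_vec (inv\<^bsub>free_group\<^esub> w) = - word_vec w"
proof -
  have "word_vec (inv\<^bsub>free_group\<^esub> w \<otimes>\<^bsub>free_group\<^esub> w) = word_vec \<one>\<^bsub>free_group\<^esub>"
    using group.l_inv[OF group_free_group assms] by simp
  then show ?thesis by (simp add: eq_neg_iff_add_eq_0)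
qed

lemma word_vec_lower_central:
  assumes "w \<in> lower_central free_group (Suc n)"
  shows "word_vec w = 0"
  using assms unfolding lower_central.simps
proof (induction rule: generate.induct)
  case one
  then show ?case by simp
next
  case (incl h)
  interpret normal "lower_central free_group n" "free_group :: gen word monoid"
    by (rule normal_lower_central_free_group)
  show ?case using incl subset by (auto simp: word_vec_inv simp del: free_group_simps(1))
next
  case (inv h)
  interpret normal "lower_central free_group n" "free_group :: gen word monoid"
    by (rule normal_lower_central_free_group)
  have "h \<in> carrier free_group" using inv subset by auto
  moreover have "word_vec h = 0"
    using inv subset by (auto simp: word_vec_inv simp del: free_group_simps(1))
  ultimately show ?case by (simp add: word_vec_inv)
next
  case (eng h1 h2)
  then show ?case by simp
qed

lemma cartan_ab_coset:
  "cartan_ab (lower_central free_group 3 #>\<^bsub>free_group\<^esub> w) = word_vec w"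
proof -
  interpret normal "lower_central free_group 3" "free_group :: gen word monoid"
    by (rule normal_lower_central_free_group)
  have "word_vec ` (lower_central free_group 3 #>\<^bsub>free_group\<^esub> w) = {word_vec w}"
    using subgroup.one_closed[OF subgroup_axioms] word_vec_lower_central[of _ 2]
    by (auto simp: r_coset_def numeral_3_eq_3 numeral_2_eq_2 image_iff simp del: lower_central.simps)
  then show ?thesis by (simp add: cartan_ab_def)
qed

lemma carrier_CartanE:
  assumes "A \<in> carrier Cartan"
  obtains w where "w \<in> carrier free_group" "A = lower_central free_group 3 #>\<^bsub>free_group\<^esub> w"
  using assms by (auto simp: Cartan_def free_nilpotent_def FactGroup_def RCOSETS_def)

lemma cartan_ab_mult:
  assumes "A \<in> carrier Cartan" "B \<in> carrier Cartan"
  shows "cartan_ab (A \<otimes>\<^bsub>Cartan\<^esub> B) = cartan_ab A + cartan_ab B"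
proof -
  interpret normal "lower_central free_group 3" "free_group :: gen word monoid"
    by (rule normal_lower_central_free_group)
  obtain v w where vw: "v \<in> carrier free_group" "w \<in> carrier free_group"
    "A = lower_central free_group 3 #>\<^bsub>free_group\<^esub> v" "B = lower_central free_group 3 #>\<^bsub>free_group\<^esub> w"
    using assms carrier_CartanE by metis
  have "A \<otimes>\<^bsub>Cartan\<^esub> B = lower_central free_group 3 #>\<^bsub>free_group\<^esub> (v \<otimes>\<^bsub>free_group\<^esub> w)"
    unfolding vw(3,4) Cartan_def free_nilpotent_def
    using rcos_sum[OF vw(1,2)] by (simp add: FactGroup_def)
  then show ?thesis unfolding vw(3,4) by (simp add: cartan_ab_coset)
qed

lemma cartan_gen_carrier: "cartan_x \<in> carrier Cartan" "cartan_y \<in> carrier Cartan"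
proof -
  have "free_nilpotent_gen n a \<in> carrier (free_nilpotent n)" for n and a :: gen
    unfolding free_nilpotent_gen_def free_nilpotent_def carrier_FactGroup
    by (rule imageI) (simp add: reduce_Cons)
  then show "cartan_x \<in> carrier Cartan" "cartan_y \<in> carrier Cartan"
    by (simp_all add: cartan_x_def cartan_y_def Cartan_def)
qed

lemma cartan_ab_one: "cartan_ab \<one>\<^bsub>Cartan\<^esub> = 0"
proof -
  interpret group Cartan by (rule group_Cartan)
  have "cartan_ab (\<one>\<^bsub>Cartan\<^esub> \<otimes>\<^bsub>Cartan\<^esub> \<one>\<^bsub>Cartan\<^esub>) = cartan_ab \<one>\<^bsub>Cartan\<^esub> + cartan_ab \<one>\<^bsub>Cartan\<^esub>"
    by (rule cartan_ab_mult) auto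
  then show ?thesis unfolding l_one[OF one_closed] by (metis add_cancel_right_left)
qed

lemma cartan_ab_inv:
  assumes "A \<in> carrier Cartan"
  shows "cartan_ab (inv\<^bsub>Cartan\<^esub> A) = - cartan_ab A"
  using cartan_ab_mult[of "inv\<^bsub>Cartan\<^esub> A" A] group_Cartan assms cartan_ab_one
  by (simp add: group.l_inv group.inv_closed eq_neg_iff_add_eq_0)

lemma cartan_ab_gens: "cartan_ab cartan_x = (1, 0)" "cartan_ab cartan_y = (0, 1)"
  by (auto simp: cartan_x_def cartan_y_def free_nilpotent_gen_def cartan_ab_coset zero_prod_def)

lemma quadrant_path_exists:
  assumes v: "fst v > 0" "snd v > 0"
  shows "\<exists>p. quadrant_path v p"
proof -
  define z where "z q = cross2 v (square_centre q)" for q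
  define U where "U = {q. z q > 0 \<or> z q = 0 \<and>
    even (card {r. z r = 0 \<and> norm (square_centre r) < norm (square_centre q)})}"
  have div: "square_division v U"
    unfolding square_division_def z_def[symmetric] by (auto simp: U_def)
  have up: "(i, j) \<in> U" if "(i, h) \<in> U" "h \<le> j" for i h j
  proof (cases "h = j")
    case False
    with that have "z (i, h) < z (i, j)"
      using v by (simp add: z_def cross2_def square_centre_def)
    with that show ?thesis by (auto simp: U_def)
  qed (use that in auto)
  have down: "(i, j) \<notin> U" if "(k, j) \<notin> U" "k \<le> i" for i k j
  proof (cases "k = i")
    case False
    with that have "z (i, j) < z (k, j)"
      using v by (simp add: z_def cross2_def square_centre_def)
    with that show ?thesis by (auto simp: U_def)
  qed (use that in auto)
  define p where "p = rec_nat (0, 0)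
    (\<lambda>_ q. if q \<in> U then (Suc (fst q), snd q) else (fst q, Suc (snd q)))"
  have p0: "p 0 = (0, 0)" by (simp add: p_def)
  have pS: "p (Suc n) = (if p n \<in> U then (Suc (fst (p n)), snd (p n)) else (fst (p n), Suc (snd (p n))))"
    for n by (simp add: p_def)
  have sum: "fst (p n) + snd (p n) = n" for n
    by (induction n) (auto simp: p0 pS)
  have sides: "(if (i, j) \<in> U then left_of_path p (i, j) else right_of_path p (i, j))" for i j
  proof -
    define out where "out n \<longleftrightarrow> \<not> (fst (p n) \<le> i \<and> snd (p n) \<le> j)" for n
    have "out (Suc (i + j))" using sum[of "Suc (i + j)"] by (auto simp: out_def)
    moreover have "\<not> out 0" by (simp add: out_def p0)
    ultimately obtain n where n: "\<not> out n" "out (Suc n)"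
      using ex_least_nat_less[of out] by blast
    obtain a b where ab: "p n = (a, b)" by force
    show ?thesis
    proof (cases "p n \<in> U")
      case True
      then have "a = i" "b \<le> j" "p (Suc n) = (Suc a, b)"
        using n ab by (auto simp: out_def pS)
      moreover from this True ab have "(i, j) \<in> U" using up by auto
      ultimately show ?thesis using ab by (auto simp: left_of_path_def)
    next
      case False
      then have "b = j" "a \<le> i" "p (Suc n) = (a, Suc b)"
        using n ab by (auto simp: out_def pS)
      moreover from this False ab have "(i, j) \<notin> U" using down by auto
      ultimately show ?thesis using ab by (auto simp: right_of_path_def)
    qed
  qed
  have "monotone_lattice_path p" by (auto simp: monotone_lattice_path_def p0 pS)
  moreover have "\<forall>q\<in>U. left_of_path p q" "\<forall>q. q \<notin> U \<longrightarrow> right_of_path p q"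
    using sides by (metis surj_pair)+
  ultimately show ?thesis using div by (auto simp: quadrant_path_def)
qed

text \<open>A lattice path lifts to the Cayley graph as soon as all its steps are unit steps.\<close>

lemma cartan_lift_exists:
  assumes "P 0 = 0"
    and step: "\<And>n. P (Suc n) - P n \<in> {(1, 0), (-1, 0), (0, 1), (0, -1)}"
  shows "\<exists>\<gamma>. \<gamma> 0 = \<one>\<^bsub>Cartan\<^esub> \<and> (\<forall>n. \<exists>s\<in>cartan_gens. \<gamma> (Suc n) = \<gamma> n \<otimes>\<^bsub>Cartan\<^esub> s) \<and>
    (\<forall>n. cartan_ab (\<gamma> n) = P n)"
proof -
  interpret group Cartan by (rule group_Cartan)
  have gens: "cartan_gens \<subseteq> carrier Cartan"
    using cartan_gen_carrier by (auto simp: cartan_gens_def)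
  have "\<exists>s\<in>cartan_gens. cartan_ab s = P (Suc n) - P n" for n
    using step[of n] by (auto simp: cartan_gens_def cartan_ab_gens cartan_ab_inv cartan_gen_carrier)
  then obtain s where s: "\<And>n. s n \<in> cartan_gens" "\<And>n. cartan_ab (s n) = P (Suc n) - P n"
    by metis
  define \<gamma> where "\<gamma> = rec_nat \<one>\<^bsub>Cartan\<^esub> (\<lambda>n g. g \<otimes>\<^bsub>Cartan\<^esub> s n)"
  have \<gamma>: "\<gamma> 0 = \<one>\<^bsub>Cartan\<^esub>" "\<gamma> (Suc n) = \<gamma> n \<otimes>\<^bsub>Cartan\<^esub> s n" for n
    by (simp_all add: \<gamma>_def)
  have "\<gamma> n \<in> carrier Cartan \<and> cartan_ab (\<gamma> n) = P n" for n
    using gens s assms(1) by (induction n) (auto simp: \<gamma> cartan_ab_one cartan_ab_mult subset_iff)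
  then show ?thesis using \<gamma> s by blast
qed

lemma cartan_ray_exists:
  assumes "u \<in> sphere 0 1"
  shows "\<exists>\<gamma>. cartan_ray u \<gamma>"
proof -
  obtain P where P: "lattice_ray u P" "P 0 = 0"
    "\<And>n. P (Suc n) - P n \<in> {(1, 0), (-1, 0), (0, 1), (0, -1)}"
  proof (cases "fst u = 0 \<or> snd u = 0")
    case True
    show ?thesis
    proof (rule that[of "\<lambda>n. real n *\<^sub>R u"])
      show "real (Suc n) *\<^sub>R u - real n *\<^sub>R u \<in> {(1, 0), (-1, 0), (0, 1), (0, -1)}" for n
      proof -
        obtain a b where u: "u = (a, b)" by force
        have "a^2 + b^2 = 1" using assms u by (simp add: norm_prod_def)
        moreover have "a = 0 \<or> b = 0" using True u by simp
        ultimately have "a = 0 \<and> (b = 1 \<or> b = -1) \<or> b = 0 \<and> (a = 1 \<or> a = -1)"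
          by (elim disjE) (simp_all add: power2_eq_1_iff)
        then have "u \<in> {(1, 0), (-1, 0), (0, 1), (0, -1)}" using u by auto
        moreover have "real (Suc n) *\<^sub>R u - real n *\<^sub>R u = u"
          by (simp add: scaleR_left_distrib)
        ultimately show ?thesis by simp
      qed
    qed (use True in \<open>auto simp: lattice_ray_def\<close>)
  next
    case False
    obtain p where p: "quadrant_path (\<bar>fst u\<bar>, \<bar>snd u\<bar>) p"
      using quadrant_path_exists[of "(\<bar>fst u\<bar>, \<bar>snd u\<bar>)"] False by auto
    define P where "P n = (sgn (fst u) * real (fst (p n)), sgn (snd u) * real (snd (p n)))" for n
    have m: "p 0 = (0, 0)"
      "p (Suc n) = (Suc (fst (p n)), snd (p n)) \<or> p (Suc n) = (fst (p n), Suc (snd (p n)))" for n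
      using p by (auto simp: quadrant_path_def monotone_lattice_path_def)
    show ?thesis
    proof (rule that[of P])
      show "P (Suc n) - P n \<in> {(1, 0), (-1, 0), (0, 1), (0, -1)}" for n
      proof -
        have "sgn (fst u) \<in> {1, -1}" "sgn (snd u) \<in> {1, -1}"
          using False by (simp_all add: sgn_if)
        then show ?thesis
          using m(2)[of n] by (elim disjE) (auto simp: P_def algebra_simps)
      qed
      show "lattice_ray u P"
        unfolding lattice_ray_def using False p by (auto simp: P_def)
      show "P 0 = 0" by (simp add: P_def m(1) zero_prod_def)
    qed
  qed
  obtain \<gamma> where \<gamma>: "\<gamma> 0 = \<one>\<^bsub>Cartan\<^esub>"
    "\<forall>n. \<exists>s\<in>cartan_gens. \<gamma> (Suc n) = \<gamma> n \<otimes>\<^bsub>Cartan\<^esub> s" "\<forall>n. cartan_ab (\<gamma> n) = P n"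
    using cartan_lift_exists[OF P(2,3)] by (elim exE conjE)
  have "(\<lambda>n. cartan_ab (\<gamma> n)) = P" using \<gamma>(3) by (simp add: fun_eq_iff)
  then have "cartan_ray u \<gamma>" unfolding cartan_ray_def using \<gamma>(1,2) P(1) by simp
  then show ?thesis by blast
qed

end

(* For u on the circle let l = cross2 u be the level (signed distance from the line R u) and let s be the
   height, the linear form with coefficients sgn(u_1), sgn(u_2). The integral of l^2 ds along a path is an
   iterated integral of length 3, hence determined by the endpoint of the path in the Cartan group. At each
   height the projection of gamma_u minimizes l^2 among the lattice points, so the excess of l^2 over this
   minimum is nonnegative, and its integral against ds along any path from e to gamma_{u,n} vanishes.
   If such a path has length at most n + B, it has few steps with ds < 1, and a maximal level D gives a total
   excess of at most const * B * D^2. Reaching level D costs an excess of order D^3, so both D and the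
   total excess are bounded in terms of B.

   If b_u and b_u' differ by a bounded function, then such almost geodesics to gamma_{u',n} pass through
   gamma_{u,k} for every k, so gamma_u stays close to the ray spanned by u', which forces u = u'. If g fixes the
   class of b_u, then so do its powers h, and almost geodesics to gamma_{u,n} run along h gamma_{u,k} for
   arbitrarily long times; unless l(g) = 0, some power makes the total excess there unbounded. *)

theory Submission
  imports Defs
begin

section \<open>Moments of lattice paths\<close>

text \<open>For \<open>u\<close> on an axis, \<open>sgn 0 = 0\<close> makes the height insensitive to steps across the axis.\<close>

definition height :: "real \<times> real \<Rightarrow> real \<times> real \<Rightarrow> real" where
  "height u z = sgn (fst u) * fst z + sgn (snd u) * snd z"

lemma height_simps [simp]:
  "height u 0 = 0" "height u (y + z) = height u y + height u z" "height u (- z) = - height u z"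
  "height u (y - z) = height u y - height u z" "height u (c *\<^sub>R z) = c * height u z"
  by (simp_all add: height_def algebra_simps)

lemma cross2_simps [simp]:
  "cross2 u 0 = 0" "cross2 u (y + z) = cross2 u y + cross2 u z" "cross2 u (- z) = - cross2 u z"
  "cross2 u (y - z) = cross2 u y - cross2 u z" "cross2 u (c *\<^sub>R z) = c * cross2 u z"
  "cross2 u u = 0"
  by (simp_all add: cross2_def algebra_simps)

text \<open>The trapezoidal sum for the integral of the squared level \<open>cross2 u\<close> against \<open>height u\<close> along the
  path spelled by the word, started at level \<open>p\<close>. On each edge it differs from the integral by a
  constant multiple of the displacement.\<close>

fun moment :: "real \<times> real \<Rightarrow> gen word \<Rightarrow> real \<Rightarrow> real" where
  "moment u [] p = 0"
| "moment u (a # w) p =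
     height u (letter_vec a) * (p\<^sup>2 + (p + cross2 u (letter_vec a))\<^sup>2) / 2
       + moment u w (p + cross2 u (letter_vec a))"

lemma moment_append:
  "moment u (v @ w) p = moment u v p + moment u w (p + cross2 u (word_vec v))"
  by (induction v arbitrary: p) (auto simp: add.assoc)

text \<open>An edge and its reverse cancel: the height step changes sign, and the trapezoidal weight
  is symmetric in the two ends. This is why moments survive free reduction.\<close>

lemma moment_push: "moment u (push a w) p = moment u (a # w) p"
proof (cases w)
  case (Cons b v)
  show ?thesis
  proof (cases "b = inv_letter a")
    case True
    then show ?thesis using Cons by (simp add: add.commute flip: add_divide_distrib)
  qed (use Cons in simp)
qed simp

lemma moment_reduce [simp]: "moment u (reduce w) p = moment u w p"
  by (induction w arbitrary: p) (auto simp: reduce_Cons moment_push)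

section \<open>Moments along the lower central series\<close>

lemma moment_inv:
  assumes "w \<in> carrier free_group"
  shows "moment u (inv\<^bsub>free_group\<^esub> w) p = - moment u w (p - cross2 u (word_vec w))"
proof -
  have "moment u (inv\<^bsub>free_group\<^esub> w \<otimes>\<^bsub>free_group\<^esub> w) p = 0"
    using group.l_inv[OF group_free_group assms] by simp
  then show ?thesis using word_vec_inv[OF assms] by (simp add: moment_append)
qed

text \<open>The forward and backward passes over \<open>g\<close> take place at levels that differ
  by the level of \<open>h\<close>, and conversely, so two differences of moments remain.\<close>

lemma moment_commutator:
  assumes "g \<in> carrier free_group" "h \<in> carrier free_group"
  shows "moment u (g \<otimes>\<^bsub>free_group\<^esub> h \<otimes>\<^bsub>free_group\<^esub> inv\<^bsub>free_group\<^esub> g \<otimes>\<^bsub>free_group\<^esub> inv\<^bsub>free_group\<^esub> h) p =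
    moment u g p - moment u g (p + cross2 u (word_vec h))
      + moment u h (p + cross2 u (word_vec g)) - moment u h p"
  using assms[THEN moment_inv] assms[THEN word_vec_inv]
  by (simp add: moment_append del: free_group_simps(1))

text \<open>The starting degree of the descent: moments become affine on
  \<open>lower_central free_group 1\<close>, constant at stage 2 and zero at stage 3.\<close>

lemma moment_quadratic: "\<exists>a b c. \<forall>p. moment u w p = a + b * p + c * p\<^sup>2"
proof (induction w)
  case Nil
  show ?case by (rule exI[of _ 0], rule exI[of _ 0], rule exI[of _ 0]) simp
next
  case (Cons l w)
  then obtain a b c where abc: "\<And>p. moment u w p = a + b * p + c * p\<^sup>2" by auto
  define s d where "s = height u (letter_vec l)" and "d = cross2 u (letter_vec l)"
  have "moment u (l # w) p = (a + b * d + c * d\<^sup>2 + s * d\<^sup>2 / 2) + (b + 2 * c * d + s * d) * p + (c + s) * p\<^sup>2" for p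
    unfolding moment.simps abc s_def[symmetric] d_def[symmetric]
    by (simp add: power2_eq_square field_simps)
  then show ?case by blast
qed

text \<open>Words from \<open>lower_central free_group (Suc n)\<close> have zero displacement, so at
  a fixed initial level their moments add under multiplication and change sign under inversion.
  Hence it is enough to control the generating commutators; \<open>Q\<close> will be a space of
  polynomials of bounded degree.\<close>

lemma moment_lower_central_induct:
  assumes w: "w \<in> lower_central free_group (Suc n)"
    and add: "\<And>f g. f \<in> Q \<Longrightarrow> g \<in> Q \<Longrightarrow> (\<lambda>p. f p + g p :: real) \<in> Q"
    and minus: "\<And>f. f \<in> Q \<Longrightarrow> (\<lambda>p. - f p) \<in> Q"
    and commutator: "\<And>g h. g \<in> lower_central free_group n \<Longrightarrow>
      (\<lambda>p. moment u g p - moment u g (p + cross2 u (word_vec h))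
        + moment u h (p + cross2 u (word_vec g)) - moment u h p) \<in> Q"
  shows "moment u w \<in> Q"
proof -
  interpret N: normal "lower_central free_group n" "free_group :: gen word monoid"
    by (rule normal_lower_central_free_group)
  let ?C = "\<Union>g \<in> lower_central free_group n. \<Union>h \<in> carrier free_group.
    {g \<otimes>\<^bsub>free_group\<^esub> h \<otimes>\<^bsub>free_group\<^esub> (inv\<^bsub>free_group\<^esub> g) \<otimes>\<^bsub>free_group\<^esub> (inv\<^bsub>free_group\<^esub> h)} :: gen word set"
  have C: "c \<in> carrier free_group \<and> moment u c \<in> Q" if "c \<in> ?C" for c
  proof -
    from that obtain g h where gh: "g \<in> lower_central free_group n" "h \<in> carrier free_group"
      "c = g \<otimes>\<^bsub>free_group\<^esub> h \<otimes>\<^bsub>free_group\<^esub> (inv\<^bsub>free_group\<^esub> g) \<otimes>\<^bsub>free_group\<^esub> (inv\<^bsub>free_group\<^esub> h)"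
      by blast
    have g: "g \<in> carrier free_group" using gh(1) N.subset by blast
    have "moment u c = (\<lambda>p. moment u g p - moment u g (p + cross2 u (word_vec h))
        + moment u h (p + cross2 u (word_vec g)) - moment u h p)"
      unfolding gh(3) by (rule ext) (rule moment_commutator[OF g gh(2)])
    moreover have "c \<in> carrier free_group"
      unfolding gh(3) using g gh(2) by (intro N.m_closed N.inv_closed)
    ultimately show ?thesis using commutator[OF gh(1)] by simp
  qed
  have zero: "(\<lambda>p. 0) \<in> Q"
    using add[OF commutator minus[OF commutator], of "[]" "[]" "[]" "[]"]
      subgroup.one_closed[OF N.subgroup_axioms] by simp
  have vec: "word_vec v = 0" if "v \<in> generate free_group ?C" for v
    using that by (intro word_vec_lower_central[of v n]) (simp only: lower_central.simps)
  have "w \<in> generate free_group ?C" using w by (simp only: lower_central.simps)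
  then show ?thesis
  proof (induction rule: generate.induct)
    case one
    have "moment u (\<one>\<^bsub>free_group\<^esub>) = (\<lambda>p. 0)" by (rule ext) simp
    then show ?case using zero by simp
  next
    case (incl h)
    then show ?case using C by blast
  next
    case (inv h)
    have h: "word_vec h = 0" by (rule vec[OF generate.incl[OF inv]])
    have "moment u (inv\<^bsub>free_group\<^esub> h) = (\<lambda>p. - moment u h p)"
      using moment_inv[of h u] C[OF inv] h by (simp add: fun_eq_iff)
    then show ?case using minus C[OF inv] by simp
  next
    case (eng h1 h2)
    have "moment u (h1 \<otimes>\<^bsub>free_group\<^esub> h2) = (\<lambda>p. moment u h1 p + moment u h2 p)"
      using vec[OF eng(1)] by (simp add: fun_eq_iff moment_append)
    then show ?case using add eng by simp
  qed
qed

text \<open>Commutation with a fixed word is a difference operator on moments, so it lowers their degree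
  as polynomials in the initial level.\<close>

lemma moment_lower_central_1:
  assumes "w \<in> lower_central free_group 1"
  shows "\<exists>a b. \<forall>p. moment u w p = a + b * p"
proof -
  have "moment u w \<in> {f. \<exists>a b. \<forall>p. f p = a + b * p}"
  proof (rule moment_lower_central_induct[of w 0])
    fix f g :: "real \<Rightarrow> real"
    assume "f \<in> {f. \<exists>a b. \<forall>p. f p = a + b * p}" "g \<in> {f. \<exists>a b. \<forall>p. f p = a + b * p}"
    then obtain a b a' b' where "\<And>p. f p = a + b * p" "\<And>p. g p = a' + b' * p" by auto
    then have "\<forall>p. f p + g p = (a + a') + (b + b') * p" by (simp add: algebra_simps)
    then show "(\<lambda>p. f p + g p) \<in> {f. \<exists>a b. \<forall>p. f p = a + b * p}" by blast
  next
    fix f :: "real \<Rightarrow> real"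
    assume "f \<in> {f. \<exists>a b. \<forall>p. f p = a + b * p}"
    then obtain a b where "\<And>p. f p = a + b * p" by auto
    then have "\<forall>p. - f p = (- a) + (- b) * p" by (simp add: algebra_simps)
    then show "(\<lambda>p. - f p) \<in> {f. \<exists>a b. \<forall>p. f p = a + b * p}" by blast
  next
    fix g h :: "gen word"
    obtain a b c where g: "\<And>p. moment u g p = a + b * p + c * p\<^sup>2" using moment_quadratic by metis
    obtain a' b' c' where h: "\<And>p. moment u h p = a' + b' * p + c' * p\<^sup>2" using moment_quadratic by metis
    define r s where "r = cross2 u (word_vec g)" and "s = cross2 u (word_vec h)"
    have "\<forall>p. moment u g p - moment u g (p + s) + moment u h (p + r) - moment u h p =
        (b' * r + c' * r\<^sup>2 - b * s - c * s\<^sup>2) + (2 * c' * r - 2 * c * s) * p"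
      by (simp add: g h power2_eq_square algebra_simps)
    then show "(\<lambda>p. moment u g p - moment u g (p + cross2 u (word_vec h))
        + moment u h (p + cross2 u (word_vec g)) - moment u h p) \<in> {f. \<exists>a b. \<forall>p. f p = a + b * p}"
      unfolding r_def[symmetric] s_def[symmetric] by blast
  qed (use assms in simp)
  then show ?thesis by simp
qed

text \<open>Now \<open>g\<close> has zero displacement: the difference of the moment of
  \<open>h\<close> disappears, and that of the affine moment of \<open>g\<close> is
  constant.\<close>

lemma moment_lower_central_2:
  assumes "w \<in> lower_central free_group 2"
  shows "\<exists>a. \<forall>p. moment u w p = a"
proof -
  have "moment u w \<in> {f. \<exists>a. \<forall>p. f p = a}"
  proof (rule moment_lower_central_induct[of w 1])
    fix g h :: "gen word"
    assume g: "g \<in> lower_central free_group 1"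
    obtain a b where ab: "\<And>p. moment u g p = a + b * p" using moment_lower_central_1[OF g] by metis
    have "word_vec g = 0" using g word_vec_lower_central[of g 0] by simp
    then show "(\<lambda>p. moment u g p - moment u g (p + cross2 u (word_vec h))
        + moment u h (p + cross2 u (word_vec g)) - moment u h p) \<in> {f. \<exists>a. \<forall>p. f p = a}"
      by (simp add: ab algebra_simps)
  qed (use assms in \<open>auto simp: numeral_2_eq_2 simp del: lower_central.simps\<close>)
  then show ?thesis by simp
qed

text \<open>Both differences vanish once \<open>g\<close> has zero displacement and constant moment.
  Hence moments descend to the 3-step quotient.\<close>

lemma moment_lower_central_3:
  assumes "w \<in> lower_central free_group 3"
  shows "moment u w p = 0"
proof -
  have "moment u w \<in> {f. \<forall>p. f p = 0}"
  proof (rule moment_lower_central_induct[of w 2])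
    fix g h :: "gen word"
    assume g: "g \<in> lower_central free_group 2"
    obtain a where a: "\<And>p. moment u g p = a" using moment_lower_central_2[OF g] by metis
    have "word_vec g = 0"
      using g word_vec_lower_central[of g 1] by (simp add: numeral_2_eq_2 del: lower_central.simps)
    then show "(\<lambda>p. moment u g p - moment u g (p + cross2 u (word_vec h))
        + moment u h (p + cross2 u (word_vec g)) - moment u h p) \<in> {f. \<forall>p. f p = 0}"
      by (simp add: a)
  qed (use assms in \<open>auto simp: numeral_3_eq_3 numeral_2_eq_2 simp del: lower_central.simps\<close>)
  then show ?thesis by simp
qed

section \<open>Words and elements of the Cartan group\<close>

text \<open>Reducing first gives meaning to words with backtracking, which arise when paths are
  concatenated.\<close>

definition word_elt :: "gen word \<Rightarrow> cartan" where
  "word_elt w = lower_central free_group 3 #>\<^bsub>free_group\<^esub> reduce w"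

lemma word_elt_carrier [simp]: "word_elt w \<in> carrier Cartan"
  by (auto simp: word_elt_def Cartan_def free_nilpotent_def FactGroup_def RCOSETS_def)

lemma word_elt_surj:
  assumes "g \<in> carrier Cartan"
  obtains w where "g = word_elt w"
proof -
  obtain w where "w \<in> carrier free_group" "g = lower_central free_group 3 #>\<^bsub>free_group\<^esub> w"
    using assms by (rule carrier_CartanE)
  then show ?thesis using that[of w] by (simp add: word_elt_def)
qed

lemma word_elt_append: "word_elt (v @ w) = word_elt v \<otimes>\<^bsub>Cartan\<^esub> word_elt w"
proof -
  interpret normal "lower_central free_group 3" "free_group :: gen word monoid"
    by (rule normal_lower_central_free_group)
  show ?thesis
    unfolding Cartan_def free_nilpotent_def word_elt_def
    using rcos_sum[of "reduce v" "reduce w"] by (simp add: FactGroup_def)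
qed

lemma word_elt_Nil: "word_elt [] = \<one>\<^bsub>Cartan\<^esub>"
proof -
  interpret group Cartan by (rule group_Cartan)
  show ?thesis using word_elt_append[of "[]" "[]"] by (simp add: l_cancel_one')
qed

lemma cartan_ab_word_elt: "cartan_ab (word_elt w) = word_vec w"
  by (simp add: word_elt_def cartan_ab_coset)

lemma word_elt_inv_letter: "word_elt [inv_letter a] = inv\<^bsub>Cartan\<^esub> word_elt [a]"
proof -
  interpret group Cartan by (rule group_Cartan)
  have "word_elt [inv_letter a] \<otimes>\<^bsub>Cartan\<^esub> word_elt [a] = word_elt [inv_letter a, a]"
    using word_elt_append[of "[inv_letter a]" "[a]"] by simp
  also have "\<dots> = \<one>\<^bsub>Cartan\<^esub>"
    using word_elt_Nil by (simp add: word_elt_def reduce_Cons)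
  finally show ?thesis using inv_equality by simp
qed

lemma cartan_gens_eq: "cartan_gens = range (\<lambda>a. word_elt [a])"
proof -
  have xy: "cartan_x = word_elt [(GX, True)]" "cartan_y = word_elt [(GY, True)]"
    by (simp_all add: cartan_x_def cartan_y_def free_nilpotent_gen_def word_elt_def reduce_Cons)
  have inv: "inv\<^bsub>Cartan\<^esub> cartan_x = word_elt [(GX, False)]" "inv\<^bsub>Cartan\<^esub> cartan_y = word_elt [(GY, False)]"
    using word_elt_inv_letter[of "(GX, True)"] word_elt_inv_letter[of "(GY, True)"]
    by (simp_all add: xy inv_letter_def)
  have "a \<in> {(GX, True), (GX, False), (GY, True), (GY, False)}" for a
    by (cases a; cases "fst a") auto
  then have UNIV: "UNIV = {(GX, True), (GX, False), (GY, True), (GY, False)}" by blast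
  show ?thesis unfolding cartan_gens_def inv unfolding xy UNIV image_insert image_empty by (rule refl)
qed

lemma foldr_word_elt: "foldr (\<otimes>\<^bsub>Cartan\<^esub>) (map (\<lambda>a. word_elt [a]) w) \<one>\<^bsub>Cartan\<^esub> = word_elt w"
proof (induction w)
  case (Cons a w)
  then show ?case using word_elt_append[of "[a]" w] by simp
qed (simp add: word_elt_Nil)

text \<open>Reduced representatives of one coset differ by a left factor in
  \<open>lower_central free_group 3\<close>, which contributes neither displacement nor
  moment.\<close>

lemma moment_word_elt_eq:
  assumes "word_elt v = word_elt w"
  shows "moment u v p = moment u w p"
proof -
  interpret normal "lower_central free_group 3" "free_group :: gen word monoid"
    by (rule normal_lower_central_free_group)
  have "reduce v \<in> lower_central free_group 3 #>\<^bsub>free_group\<^esub> reduce v"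
    by (rule rcos_self[OF _ subgroup_axioms]) simp
  also have "\<dots> = lower_central free_group 3 #>\<^bsub>free_group\<^esub> reduce w"
    using assms unfolding word_elt_def .
  finally have "reduce v \<in> lower_central free_group 3 #>\<^bsub>free_group\<^esub> reduce w" .
  then obtain n where n: "n \<in> lower_central free_group 3" "reduce v = n \<otimes>\<^bsub>free_group\<^esub> reduce w"
    unfolding r_coset_def by blast
  have "word_vec n = 0"
    using n(1) word_vec_lower_central[of n 2] by (simp add: numeral_3_eq_3 numeral_2_eq_2 del: lower_central.simps)
  moreover have "moment u v p = moment u (n \<otimes>\<^bsub>free_group\<^esub> reduce w) p"
    using n(2) moment_reduce by metis
  ultimately show ?thesis using moment_lower_central_3[OF n(1)] by (simp add: moment_append)
qed

section \<open>The lattice rays\<close>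

lemma monotone_lattice_path_sum:
  "monotone_lattice_path p \<Longrightarrow> fst (p n) + snd (p n) = n"
proof (induction n)
  case (Suc n)
  then show ?case unfolding monotone_lattice_path_def by (metis add_Suc add_Suc_right fst_conv snd_conv)
qed (simp add: monotone_lattice_path_def)

lemma monotone_lattice_path_mono:
  assumes "monotone_lattice_path p" "m \<le> n"
  shows "fst (p m) \<le> fst (p n)" "snd (p m) \<le> snd (p n)"
proof -
  have "fst (p n) \<le> fst (p (Suc n)) \<and> snd (p n) \<le> snd (p (Suc n))" for n
    using assms(1) unfolding monotone_lattice_path_def by (metis fst_conv snd_conv le_Suc_eq order_refl)
  then show "fst (p m) \<le> fst (p n)" "snd (p m) \<le> snd (p n)"
    using lift_Suc_mono_le[of "\<lambda>n. fst (p n)"] lift_Suc_mono_le[of "\<lambda>n. snd (p n)"] assms(2) by auto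
qed

text \<open>A vertical edge to the left of the square would, by monotonicity, either lift the path
  above row \<open>j\<close> before time \<open>n\<close> or come after the path has left column
  \<open>i\<close>. So the direction of the step out of \<open>(i, j)\<close> reveals the category
  of the square \<open>(i, j)\<close>.\<close>

lemma not_right_of_path:
  assumes p: "monotone_lattice_path p" and n: "p n = (i, j)" "p (Suc n) = (Suc i, j)"
  shows "\<not> right_of_path p (i, j)"
proof
  assume "right_of_path p (i, j)"
  then obtain m k where m: "k \<le> i" "p m = (k, j)" "p (Suc m) = (k, Suc j)"
    by (auto simp: right_of_path_def)
  show False
  proof (cases m n rule: linorder_cases)
    case less
    then show False using monotone_lattice_path_mono(2)[OF p, of "Suc m" n] m n by simp
  next
    case equal
    then show False using m n by simp
  next
    case greater
    then show False using monotone_lattice_path_mono(1)[OF p, of "Suc n" m] m n by simp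
  qed
qed

lemma not_left_of_path:
  assumes p: "monotone_lattice_path p" and n: "p n = (i, j)" "p (Suc n) = (i, Suc j)"
  shows "\<not> left_of_path p (i, j)"
proof
  assume "left_of_path p (i, j)"
  then obtain m k where m: "k \<le> j" "p m = (i, k)" "p (Suc m) = (Suc i, k)"
    by (auto simp: left_of_path_def)
  show False
  proof (cases m n rule: linorder_cases)
    case less
    then show False using monotone_lattice_path_mono(1)[OF p, of "Suc m" n] m n by simp
  next
    case equal
    then show False using m n by simp
  next
    case greater
    then show False using monotone_lattice_path_mono(2)[OF p, of "Suc n" m] m n by simp
  qed
qed

text \<open>A step is horizontal only if the level is at least \<open>(snd v - fst v) / 2\<close>,
  and it lowers the level by \<open>snd v\<close>; it is vertical only if the level is at most that
  value, and it raises the level by \<open>fst v\<close>. Both keep the level within the bound, also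
  when the square is centred on the ray and either step may occur.\<close>

lemma quadrant_path_level:
  assumes p: "quadrant_path v p" and v: "fst v > 0" "snd v > 0"
  shows "\<bar>cross2 v (real (fst (p n)), real (snd (p n)))\<bar> \<le> (fst v + snd v) / 2"
proof (induction n)
  case 0
  then show ?case using p v by (simp add: quadrant_path_def monotone_lattice_path_def cross2_def)
next
  case (Suc n)
  from p obtain U where m: "monotone_lattice_path p" and U: "square_division v U"
    "\<forall>q\<in>U. left_of_path p q" "\<forall>q. q \<notin> U \<longrightarrow> right_of_path p q"
    by (auto simp: quadrant_path_def)
  obtain i j where ij: "p n = (i, j)" by force
  consider "p (Suc n) = (Suc i, j)" | "p (Suc n) = (i, Suc j)"
    using m ij unfolding monotone_lattice_path_def by (metis fst_conv snd_conv)
  then show ?case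
  proof cases
    case 1
    then have "(i, j) \<in> U" using not_right_of_path[OF m ij] U(3) by blast
    then have "cross2 v (square_centre (i, j)) \<ge> 0"
      using U(1) unfolding square_division_def by (meson linorder_not_le)
    then have "fst v * (real j + 1 / 2) \<ge> snd v * (real i + 1 / 2)"
      by (simp add: cross2_def square_centre_def)
    then have "fst v * real j - snd v * real i \<ge> (snd v - fst v) / 2"
      by (simp add: field_simps)
    moreover have "\<bar>fst v * real j - snd v * real i\<bar> \<le> (fst v + snd v) / 2"
      using Suc ij by (simp add: cross2_def)
    ultimately have "\<bar>fst v * real j - snd v * real i - snd v\<bar> \<le> (fst v + snd v) / 2"
      using v unfolding abs_le_iff by argo
    then show ?thesis using 1 by (simp add: cross2_def algebra_simps)
  next
    case 2
    then have "(i, j) \<notin> U" using not_left_of_path[OF m ij] U(2) by blast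
    then have "cross2 v (square_centre (i, j)) \<le> 0"
      using U(1) unfolding square_division_def by (meson linorder_not_le)
    then have "fst v * (real j + 1 / 2) \<le> snd v * (real i + 1 / 2)"
      by (simp add: cross2_def square_centre_def)
    then have "fst v * real j - snd v * real i \<le> (snd v - fst v) / 2"
      by (simp add: field_simps)
    moreover have "\<bar>fst v * real j - snd v * real i\<bar> \<le> (fst v + snd v) / 2"
      using Suc ij by (simp add: cross2_def)
    ultimately have "\<bar>fst v * real j - snd v * real i + fst v\<bar> \<le> (fst v + snd v) / 2"
      using v unfolding abs_le_iff by argo
    then show ?thesis using 2 by (simp add: cross2_def algebra_simps)
  qed
qed

section \<open>Height and level along the rays of the unit circle\<close>

lemma sphere_prod_eq: "u \<in> sphere 0 1 \<longleftrightarrow> (fst u)\<^sup>2 + (snd u)\<^sup>2 = (1 :: real)"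
  by (cases u) (simp add: norm_prod_def)

lemma sphere_abs_le_1:
  assumes "u \<in> sphere (0 :: real \<times> real) 1"
  shows "\<bar>fst u\<bar> \<le> 1" "\<bar>snd u\<bar> \<le> 1"
proof -
  have "(fst u)\<^sup>2 \<le> 1" "(snd u)\<^sup>2 \<le> 1"
    using assms zero_le_power2[of "fst u"] zero_le_power2[of "snd u"] unfolding sphere_prod_eq by linarith+
  then show "\<bar>fst u\<bar> \<le> 1" "\<bar>snd u\<bar> \<le> 1" by (simp_all add: abs_square_le_1)
qed

context
  fixes u :: "real \<times> real" and V :: "nat \<Rightarrow> real \<times> real"
  assumes u: "u \<in> sphere 0 1" and V: "lattice_ray u V"
begin

lemma lattice_ray_cases:
  obtains (axis) "fst u = 0 \<or> snd u = 0" "\<And>n. V n = real n *\<^sub>R u" "\<bar>fst u\<bar> + \<bar>snd u\<bar> = 1"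
  | (quadrant) p where "fst u \<noteq> 0" "snd u \<noteq> 0" "quadrant_path (\<bar>fst u\<bar>, \<bar>snd u\<bar>) p"
    "\<And>n. V n = (sgn (fst u) * real (fst (p n)), sgn (snd u) * real (snd (p n)))"
proof (cases "fst u = 0 \<or> snd u = 0")
  case True
  then have "\<bar>fst u\<bar> + \<bar>snd u\<bar> = 1" using u unfolding sphere_prod_eq by (auto simp: power2_eq_1_iff)
  then show ?thesis using that(1) True V by (simp add: lattice_ray_def)
next
  case False
  then show ?thesis using that(2) V unfolding lattice_ray_def by (metis (no_types, lifting))
qed

lemma lattice_ray_height: "height u (V n) = real n"
proof (cases rule: lattice_ray_cases)
  case axis
  then show ?thesis by (auto simp: height_def algebra_simps abs_sgn)
next
  case (quadrant p)
  have "fst (p n) + snd (p n) = n"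
    using quadrant(3) monotone_lattice_path_sum by (auto simp: quadrant_path_def)
  moreover have "sgn (fst u) * sgn (fst u) = 1" "sgn (snd u) * sgn (snd u) = 1"
    using quadrant(1,2) by (auto simp: sgn_if)
  ultimately show ?thesis using quadrant(4) by (simp add: height_def flip: mult.assoc)
qed

text \<open>Reflecting the quadrant changes at most the sign of the level, and the square of the
  mean of the absolute values of the coordinates is at most half the sum of their squares.\<close>

lemma lattice_ray_level_sq: "(cross2 u (V n))\<^sup>2 \<le> 1 / 2"
proof (cases rule: lattice_ray_cases)
  case axis
  then show ?thesis by simp
next
  case (quadrant p)
  define L where "L = cross2 (\<bar>fst u\<bar>, \<bar>snd u\<bar>) (real (fst (p n)), real (snd (p n)))"
  have "\<bar>L\<bar> \<le> (\<bar>fst u\<bar> + \<bar>snd u\<bar>) / 2"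
    using quadrant_path_level[OF quadrant(3)] quadrant(1,2) by (simp add: L_def)
  then have "L\<^sup>2 \<le> ((\<bar>fst u\<bar> + \<bar>snd u\<bar>) / 2)\<^sup>2"
    by (rule power2_le_iff_abs_le[THEN iffD2, rotated]) simp
  also have "\<dots> \<le> ((fst u)\<^sup>2 + (snd u)\<^sup>2) / 2"
    using zero_le_power2[of "\<bar>fst u\<bar> - \<bar>snd u\<bar>"] by (simp add: power2_eq_square field_simps)
  finally have "L\<^sup>2 \<le> 1 / 2" using u unfolding sphere_prod_eq by simp
  moreover have "cross2 u (V n) = sgn (fst u) * sgn (snd u) * L"
    using quadrant(1,2,4) by (auto simp: L_def cross2_def sgn_if algebra_simps)
  ultimately show ?thesis using quadrant(1,2) by (auto simp: sgn_if)
qed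

lemma lattice_ray_level: "\<bar>cross2 u (V n)\<bar> \<le> 1"
proof -
  have "(cross2 u (V n))\<^sup>2 \<le> 1\<^sup>2" using lattice_ray_level_sq[of n] by simp
  then show ?thesis by (simp only: power2_le_iff_abs_le zero_le_one)
qed

text \<open>Consecutive lattice points of an antidiagonal differ in level by $|u_1| + |u_2|$, which is
  twice the bound on the level of the ray.\<close>

lemma lattice_ray_level_minimal:
  assumes z: "z = (of_int a, of_int b)" "\<bar>height u z\<bar> = real n"
  shows "(cross2 u (V n))\<^sup>2 \<le> (cross2 u z)\<^sup>2"
proof (cases rule: lattice_ray_cases)
  case axis
  then show ?thesis by simp
next
  case (quadrant p)
  have main: "(cross2 u (V n))\<^sup>2 \<le> (cross2 u z)\<^sup>2"
    if z: "z = (of_int a, of_int b)" "height u z = real n" for z a b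
  proof -
    define c L where "c = \<bar>fst u\<bar> + \<bar>snd u\<bar>" and
      "L = cross2 (\<bar>fst u\<bar>, \<bar>snd u\<bar>) (real (fst (p n)), real (snd (p n)))"
    have L: "\<bar>L\<bar> \<le> c / 2"
      using quadrant_path_level[OF quadrant(3)] quadrant(1,2) by (simp add: L_def c_def)
    have sum: "real (fst (p n)) = real n - real (snd (p n))"
      using quadrant(3) monotone_lattice_path_sum[of p n] by (auto simp: quadrant_path_def)
    \<comment> \<open>After reflection to the first quadrant, \<open>t\<close> counts the
      antidiagonal steps from the vertex of the ray to \<open>z\<close>.\<close>
    obtain t where t: "of_int t = sgn (snd u) * of_int b - real (snd (p n))"
    proof (cases "snd u > 0")
      case True
      then show ?thesis using that[of "b - int (snd (p n))"] by simp
    next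
      case False
      then show ?thesis using quadrant(2) that[of "- b - int (snd (p n))"] by simp
    qed
    have s: "sgn (fst u) \<in> {1, -1}" "sgn (snd u) \<in> {1, -1}"
      using quadrant(1,2) by (simp_all add: sgn_if)
    have V: "cross2 u (V n) = sgn (fst u) * sgn (snd u) * L"
      using quadrant(1,2,4) by (auto simp: L_def cross2_def sgn_if algebra_simps)
    have b: "of_int b = sgn (snd u) * (of_int t + real (snd (p n)))" using t s by auto
    have a: "of_int a = sgn (fst u) * (real (fst (p n)) - of_int t)"
      using z s t sum by (auto simp: height_def)
    have "cross2 u z = sgn (fst u) * sgn (snd u) * (L + of_int t * c)"
      unfolding z cross2_def fst_conv snd_conv a b
      using quadrant(1,2) by (auto simp: L_def c_def cross2_def sgn_if algebra_simps)
    moreover have "\<bar>L\<bar> \<le> \<bar>L + of_int t * c\<bar>"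
    proof (cases "t = 0")
      case False
      then have "1 \<le> \<bar>of_int t :: real\<bar>" by linarith
      then have "c \<le> \<bar>of_int t * c\<bar>"
        using mult_right_mono[of 1 "\<bar>of_int t\<bar>" c] by (simp add: abs_mult c_def)
      then show ?thesis using L by linarith
    qed simp
    ultimately have "\<bar>cross2 u (V n)\<bar> \<le> \<bar>cross2 u z\<bar>" using V s by (auto simp: abs_mult)
    then show ?thesis by (simp only: abs_le_square_iff)
  qed
  \<comment> \<open>A point of negative height is compared through its antipode, which has the same
    squared level.\<close>
  show ?thesis
  proof (cases "height u z \<ge> 0")
    case True
    then show ?thesis using main z by simp
  next
    case False
    then have "height u (- z) = real n" using z(2) by (simp only: height_simps)
    then have "(cross2 u (V n))\<^sup>2 \<le> (cross2 u (- z))\<^sup>2"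
      using z(1) by (intro main[of _ "- a" "- b"]) simp_all
    then show ?thesis by simp
  qed
qed

end

section \<open>Almost geodesic paths follow the ray\<close>

text \<open>If $D$ is the largest level, then by balance the few non-forward steps bound the total excess by
  a multiple of $B D^2$; but reaching level $D$ in unit steps costs an excess of order $D^3$.\<close>

lemma almost_forward_bound:
  fixes l m e :: "nat \<Rightarrow> real" and B :: real
  assumes e: "\<And>i. i < N \<Longrightarrow> e i \<le> 1" and B: "(\<Sum>i<N. 1 - e i) \<le> B"
    and l: "l 0 = 0" "\<And>i. i < N \<Longrightarrow> \<bar>l (Suc i) - l i\<bar> \<le> 1"
    and m: "\<And>i. i \<le> N \<Longrightarrow> 0 \<le> m i" "\<And>i. i \<le> N \<Longrightarrow> m i \<le> 1 / 2" "\<And>i. i \<le> N \<Longrightarrow> m i \<le> (l i)\<^sup>2"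
    and balance: "(\<Sum>i<N. e i * (((l i)\<^sup>2 - m i) + ((l (Suc i))\<^sup>2 - m (Suc i)))) = 0"
  shows "j \<le> N \<Longrightarrow> \<bar>l j\<bar> \<le> 16 * B + 2"
    and "(\<Sum>i\<le>N. (l i)\<^sup>2 - m i) \<le> 2 * B * (16 * B + 2)\<^sup>2"
proof -
  define h where "h i = (l i)\<^sup>2 - m i" for i
  have h: "0 \<le> h i" "h i \<le> (l i)\<^sup>2" "(l i)\<^sup>2 - 1 / 2 \<le> h i" if "i \<le> N" for i
    using m[OF that] by (auto simp: h_def)
  define D where "D = Max ((\<lambda>i. \<bar>l i\<bar>) ` {..N})"
  have D: "\<bar>l i\<bar> \<le> D" if "i \<le> N" for i using that by (simp add: D_def)
  have "D \<in> (\<lambda>i. \<bar>l i\<bar>) ` {..N}" unfolding D_def by (rule Max_in) auto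
  then obtain k where k: "k \<le> N" "D = \<bar>l k\<bar>" by blast
  have hD: "h i \<le> D\<^sup>2" if "i \<le> N" for i
    using h(2)[OF that] D[OF that] by (metis abs_ge_zero order_trans power2_abs power_mono)
  have B0: "0 \<le> B" using e B sum_nonneg[of "{..<N}" "\<lambda>i. 1 - e i"] by force
  have "h 0 = 0" using m(1,3)[of 0] l by (simp add: h_def)
  have "(\<Sum>i\<le>N. h i) = (\<Sum>i<N. h (Suc i))"
    using \<open>h 0 = 0\<close> by (simp add: sum.atMost_shift)
  also have "\<dots> \<le> (\<Sum>i<N. h i + h (Suc i))"
    by (rule sum_mono) (use h in auto)
  \<comment> \<open>Subtracting the vanishing sum of \<open>balance\<close> replaces the weight 1 by
    \<open>1 - e i\<close>, which is zero on forward steps.\<close>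
  also have "\<dots> = (\<Sum>i<N. (1 - e i) * (h i + h (Suc i)))"
    using balance by (simp add: h_def sum_subtractf algebra_simps sum.distrib)
  also have "\<dots> \<le> (\<Sum>i<N. (1 - e i) * (2 * D\<^sup>2))"
  proof (rule sum_mono)
    fix i assume "i \<in> {..<N}"
    then show "(1 - e i) * (h i + h (Suc i)) \<le> (1 - e i) * (2 * D\<^sup>2)"
      using hD[of i] hD[of "Suc i"] e[of i] by (intro mult_left_mono) auto
  qed
  also have "\<dots> \<le> B * (2 * D\<^sup>2)"
    unfolding sum_distrib_right[symmetric] using B by (intro mult_right_mono) auto
  finally have sum_le: "(\<Sum>i\<le>N. h i) \<le> 2 * B * D\<^sup>2" by simp
  have lip: "\<bar>l (i + t) - l i\<bar> \<le> real t" if "i + t \<le> N" for i t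
    using that
  proof (induction t)
    case (Suc t)
    then show ?case using l(2)[of "i + t"] by simp
  qed simp
  have D_bound: "D \<le> 16 * B + 2"
  proof (rule ccontr)
    assume "\<not> D \<le> 16 * B + 2"
    then have big: "D > 16 * B + 2" by simp
    with B0 have D2: "D > 2" by linarith
    then have D4: "4 \<le> D\<^sup>2" using power_mono[of 2 D 2] by simp
    \<comment> \<open>During the last \<open>r\<close> steps before time \<open>k\<close> the level
      stays at least \<open>D / 2\<close>, which gives at least \<open>D / 2\<close> vertices of
      excess at least \<open>D\<^sup>2 / 4 - 1 / 2\<close>.\<close>
    define r where "r = nat \<lfloor>D / 2\<rfloor>"
    have r: "real r \<le> D / 2" "D / 2 \<le> real r + 1" using D2 unfolding r_def by linarith+
    have "D \<le> real k" using lip[of 0 k] k(1) l(1) by (simp add: k(2))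
    then have "r \<le> k" using r D2 by linarith
    have "D / 2 * (D\<^sup>2 / 4 - 1 / 2) \<le> (real r + 1) * (D\<^sup>2 / 4 - 1 / 2)"
      using r D4 by (intro mult_right_mono) auto
    also have "\<dots> = real (card {k - r..k}) * (D\<^sup>2 / 4 - 1 / 2)"
      using \<open>r \<le> k\<close> by (simp add: Suc_diff_le)
    also have "\<dots> \<le> (\<Sum>i\<in>{k - r..k}. h i)"
    proof (rule sum_bounded_below)
      fix i assume i: "i \<in> {k - r..k}"
      then have "i \<le> k" "k - i \<le> r" using \<open>r \<le> k\<close> by auto
      then have "\<bar>l k - l i\<bar> \<le> real r" using lip[of i "k - i"] k(1) by auto
      then have "D / 2 \<le> \<bar>l i\<bar>" using r(1) by (simp add: k(2))
      then have "(D / 2)\<^sup>2 \<le> (l i)\<^sup>2" using D2 power_mono[of "D / 2" "\<bar>l i\<bar>" 2] by simp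
      then show "D\<^sup>2 / 4 - 1 / 2 \<le> h i" using h(3)[of i] \<open>i \<le> k\<close> k(1) by (simp add: power_divide)
    qed
    also have "\<dots> \<le> (\<Sum>i\<le>N. h i)"
      using k(1) h(1) by (intro sum_mono2) auto
    also note sum_le
    \<comment> \<open>Clearing denominators and cancelling \<open>D\<close> gives
      \<open>D\<^sup>2 \<le> 16 * B * D + 2\<close>; this is the source of the bound
      \<open>16 * B + 2\<close>.\<close>
    finally have "D * (D\<^sup>2) \<le> D * (16 * B * D + 2)" by (simp add: power2_eq_square field_simps)
    then have "D\<^sup>2 \<le> 16 * B * D + 2" using D2 by (simp only: mult_le_cancel_left_pos)
    moreover have "(16 * B + 2) * D < D * D" using big D2 by (intro mult_strict_right_mono) auto
    ultimately show False using D2 by (simp add: power2_eq_square algebra_simps)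
  qed
  show "\<bar>l j\<bar> \<le> 16 * B + 2" if "j \<le> N" using D[OF that] D_bound by simp
  have "D\<^sup>2 \<le> (16 * B + 2)\<^sup>2" using D_bound by (intro power_mono) (auto simp: k(2))
  then have "2 * B * D\<^sup>2 \<le> 2 * B * (16 * B + 2)\<^sup>2" using B0 by (intro mult_left_mono) auto
  then show "(\<Sum>i\<le>N. (l i)\<^sup>2 - m i) \<le> 2 * B * (16 * B + 2)\<^sup>2" using sum_le by (simp add: h_def)
qed

text \<open>Lets sums of a function of the height telescope along paths that may descend and reach
  negative heights.\<close>

lemma int_antidifference:
  fixes f :: "int \<Rightarrow> real"
  obtains M where "\<And>k. M (k + 1) - M k = f k"
proof
  fix k :: int
  let ?M = "\<lambda>k. (\<Sum>j\<in>{0..<k}. f j) - (\<Sum>j\<in>{k..<0}. f j)"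
  show "?M (k + 1) - ?M k = f k"
  proof (cases "k \<ge> 0")
    case True
    then have "{0..<k + 1} = insert k {0..<k}" by auto
    with True show ?thesis by simp
  next
    case False
    have "j \<in> {k..<0} \<longleftrightarrow> j = k \<or> j \<in> {k + 1..<0}" for j
      using False by (simp only: atLeastLessThan_iff) arith
    then have "{k..<0} = insert k {k + 1..<0}" by blast
    with False show ?thesis by simp
  qed
qed

section \<open>Heights, levels and excess along words\<close>

lemma word_vec_int: obtains a b where "word_vec w = (of_int a, of_int b)"
proof -
  have "\<exists>a b. word_vec w = (of_int a, of_int b)"
  proof (induction w)
    case Nil
    show ?case by (intro exI[of _ 0]) (simp add: zero_prod_def)
  next
    case (Cons l w)
    then obtain a b where "word_vec w = (of_int a, of_int b)" by auto
    moreover obtain c d where "letter_vec l = (of_int c, of_int d)"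
    proof (cases l rule: letter_vec.cases)
      case (1 s)
      then show ?thesis using that[of "if s then 1 else -1" 0] by simp
    next
      case (2 s)
      then show ?thesis using that[of 0 "if s then 1 else -1"] by simp
    qed
    ultimately show ?case by (intro exI[of _ "a + c"] exI[of _ "b + d"]) simp
  qed
  then show ?thesis using that by auto
qed

lemma height_letter: "height u (letter_vec a) \<in> {-1, 0, 1}"
  by (cases a rule: letter_vec.cases) (auto simp: height_def sgn_if)

lemma height_word: "\<bar>height u (word_vec w)\<bar> \<le> real (length w)"
proof (induction w)
  case (Cons a w)
  then show ?case using height_letter[of u a] by auto
qed simp

lemma height_word_int: "of_int \<lfloor>height u (word_vec w)\<rfloor> = height u (word_vec w)"
proof -
  have "height u (word_vec w) \<in> \<int>"
  proof (induction w)
    case (Cons a w)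
    have "height u (letter_vec a) \<in> \<int>" using height_letter[of u a] by auto
    then show ?case using Cons by simp
  qed simp
  then show ?thesis by simp
qed

lemma cross2_letter:
  assumes "u \<in> sphere 0 1"
  shows "\<bar>cross2 u (letter_vec a)\<bar> \<le> 1"
  using sphere_abs_le_1[OF assms] by (cases a rule: letter_vec.cases) (auto simp: cross2_def)

lemma word_vec_take_Suc:
  "i < length w \<Longrightarrow> word_vec (take (Suc i) w) = word_vec (take i w) + letter_vec (w ! i)"
  by (simp add: take_Suc_conv_app_nth)

lemma moment_eq_sum:
  "moment u w 0 = (\<Sum>i<length w. height u (letter_vec (w ! i)) *
     ((cross2 u (word_vec (take i w)))\<^sup>2 + (cross2 u (word_vec (take (Suc i) w)))\<^sup>2) / 2)"
proof (induction w rule: rev_induct)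
  case (snoc a w)
  have "moment u (w @ [a]) 0 = moment u w 0 + height u (letter_vec a) *
     ((cross2 u (word_vec w))\<^sup>2 + (cross2 u (word_vec w + letter_vec a))\<^sup>2) / 2"
    by (simp add: moment_append)
  also have "moment u w 0 = (\<Sum>i<length w. height u (letter_vec ((w @ [a]) ! i)) *
     ((cross2 u (word_vec (take i (w @ [a]))))\<^sup>2 + (cross2 u (word_vec (take (Suc i) (w @ [a]))))\<^sup>2) / 2)"
    unfolding snoc by (rule sum.cong) (auto simp: nth_append)
  finally show ?case by simp
qed simp

text \<open>The vertex of the ray at height \<open>k\<close> has index \<open>k\<close>. The floor
  only turns an integral height into an \<open>int\<close>, and the absolute value extends the
  comparison to negative heights by central symmetry.\<close>

definition excess :: "real \<times> real \<Rightarrow> (nat \<Rightarrow> real \<times> real) \<Rightarrow> real \<times> real \<Rightarrow> real" where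
  "excess u V z = (cross2 u z)\<^sup>2 - (cross2 u (V (nat \<bar>\<lfloor>height u z\<rfloor>\<bar>)))\<^sup>2"

text \<open>Twice the trapezoidal sum for the integral of the excess against the height.\<close>

definition excess_sum :: "real \<times> real \<Rightarrow> (nat \<Rightarrow> real \<times> real) \<Rightarrow> gen word \<Rightarrow> real" where
  "excess_sum u V w = (\<Sum>i<length w. height u (letter_vec (w ! i)) *
     (excess u V (word_vec (take i w)) + excess u V (word_vec (take (Suc i) w))))"

text \<open>The excess sum is twice the moment minus a sum of a function of the height alone. The
  first depends only on the group element; the second telescopes, so it depends only on the final
  height.\<close>

lemma excess_sum_cong:
  assumes "word_elt v = word_elt w"
  shows "excess_sum u V v = excess_sum u V w"
proof -
  define m where "m k = (cross2 u (V (nat \<bar>k\<bar>)))\<^sup>2" for k :: int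
  obtain M where M: "\<And>k. M (k + 1) - M k = m k + m (k + 1)"
    using int_antidifference[of "\<lambda>k. m k + m (k + 1)"] by blast
  have "excess_sum u V w = 2 * moment u w 0 - (M \<lfloor>height u (word_vec w)\<rfloor> - M 0)" for w
  proof -
    define H where "H i = \<lfloor>height u (word_vec (take i w))\<rfloor>" for i
    \<comment> \<open>The weight is symmetric in the two heights, so one antidifference serves
      ascending and descending edges.\<close>
    have step: "height u (letter_vec (w ! i)) * (m (H i) + m (H (Suc i))) = M (H (Suc i)) - M (H i)"
      if "i < length w" for i
    proof -
      have Suc: "real_of_int (H (Suc i)) = real_of_int (H i) + height u (letter_vec (w ! i))"
        unfolding H_def height_word_int unfolding word_vec_take_Suc[OF that] by simp
      consider "height u (letter_vec (w ! i)) = 1" | "height u (letter_vec (w ! i)) = 0"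
        | "height u (letter_vec (w ! i)) = -1"
        using height_letter[of u "w ! i"] by auto
      then show ?thesis
      proof cases
        case 1
        then have "H (Suc i) = H i + 1" using Suc by linarith
        then show ?thesis using 1 M[of "H i"] by simp
      next
        case 2
        then have "H (Suc i) = H i" using Suc by linarith
        then show ?thesis using 2 by simp
      next
        case 3
        then have "H i = H (Suc i) + 1" using Suc by linarith
        then show ?thesis using 3 M[of "H (Suc i)"] by simp
      qed
    qed
    have "(\<Sum>i<length w. height u (letter_vec (w ! i)) * (m (H i) + m (H (Suc i))))
      = (\<Sum>i<length w. M (H (Suc i)) - M (H i))"
      by (rule sum.cong) (simp_all add: step)
    also have "\<dots> = M \<lfloor>height u (word_vec w)\<rfloor> - M 0"
      by (subst sum_lessThan_telescope) (simp add: H_def)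
    finally have "(\<Sum>i<length w. height u (letter_vec (w ! i)) * (m (H i) + m (H (Suc i))))
      = M \<lfloor>height u (word_vec w)\<rfloor> - M 0" .
    moreover have "excess_sum u V w = 2 * moment u w 0
      - (\<Sum>i<length w. height u (letter_vec (w ! i)) * (m (H i) + m (H (Suc i))))"
      unfolding excess_sum_def moment_eq_sum excess_def sum_distrib_left sum_subtractf[symmetric]
        m_def[symmetric] H_def[symmetric]
      by (rule sum.cong) (simp_all add: algebra_simps)
    ultimately show ?thesis by simp
  qed
  moreover have "word_vec v = word_vec w" using assms by (metis cartan_ab_word_elt)
  ultimately show ?thesis using moment_word_elt_eq[OF assms] by simp
qed

section \<open>Paths to a vertex of the ray with bounded extra length\<close>

context
  fixes u :: "real \<times> real" and V :: "nat \<Rightarrow> real \<times> real" and a :: "nat \<Rightarrow> gen \<times> bool"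
  assumes u: "u \<in> sphere 0 1" and V: "lattice_ray u V"
    and a: "\<And>n. word_vec (map a [0..<n]) = V n"
begin

lemma excess_nonneg: "excess u V (word_vec w) \<ge> 0"
proof -
  obtain b c where "word_vec w = (of_int b, of_int c)" by (rule word_vec_int)
  moreover have "\<bar>height u (word_vec w)\<bar> = real (nat \<bar>\<lfloor>height u (word_vec w)\<rfloor>\<bar>)"
    using height_word_int[of u w] by (metis of_int_abs of_nat_nat abs_ge_zero of_int_of_nat_eq)
  ultimately show ?thesis
    unfolding excess_def using lattice_ray_level_minimal[OF u V] by force
qed

lemma excess_ray: "excess u V (V n) = 0"
  using lattice_ray_height[OF u V, of n] by (simp add: excess_def)

text \<open>The ray is minimal at each of its heights. With \<open>excess_sum_cong\<close>, every
  path spelling the same element therefore has excess sum zero.\<close>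

lemma excess_sum_ray: "excess_sum u V (map a [0..<n]) = 0"
proof -
  have "excess u V (word_vec (take i (map a [0..<n]))) = 0" if "i \<le> n" for i
    using that a[of i] excess_ray by (simp add: take_map)
  then show ?thesis by (simp add: excess_sum_def)
qed

context
  fixes w :: "gen word" and n :: nat and B :: real
  assumes w: "word_elt w = word_elt (map a [0..<n])" and B: "real (length w) \<le> real n + B"
begin

lemma almost_geodesic_vec: "word_vec w = V n"
  using w a[of n] by (metis cartan_ab_word_elt)

text \<open>The remaining letters can raise the height by at most their number, and the final height
  is \<open>n\<close>. This bound later separates a direction from its opposite.\<close>

lemma almost_geodesic_height:
  assumes "j \<le> length w"
  shows "- B \<le> height u (word_vec (take j w))"
proof -
  have "height u (word_vec (take j w)) + height u (word_vec (drop j w)) = real n"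
    using lattice_ray_height[OF u V, of n] almost_geodesic_vec
    by (metis append_take_drop_id height_simps(2) word_vec_simps(3))
  moreover have "height u (word_vec (drop j w)) \<le> real (length w - j)"
    using height_word[of u "drop j w"] by simp
  ultimately show ?thesis using B assms by (simp add: of_nat_diff)
qed

lemma almost_geodesic_level:
    "j \<le> length w \<Longrightarrow> \<bar>cross2 u (word_vec (take j w))\<bar> \<le> 16 * B + 2" (is "_ \<Longrightarrow> ?level")
  and almost_geodesic_excess:
    "(\<Sum>i\<le>length w. excess u V (word_vec (take i w))) \<le> 2 * B * (16 * B + 2)\<^sup>2" (is ?excess)
proof -
  let ?l = "\<lambda>i. cross2 u (word_vec (take i w))"
  let ?m = "\<lambda>i. (cross2 u (V (nat \<bar>\<lfloor>height u (word_vec (take i w))\<rfloor>\<bar>)))\<^sup>2"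
  let ?e = "\<lambda>i. height u (letter_vec (w ! i))"
  \<comment> \<open>The height steps add up to \<open>n\<close>, so the total shortfall from pure
    forward motion is \<open>length w - n\<close>.\<close>
  have "(\<Sum>i<length w. ?e i) = (\<Sum>i<length w. height u (word_vec (take (Suc i) w)) - height u (word_vec (take i w)))"
    by (rule sum.cong) (simp_all add: word_vec_take_Suc)
  also have "\<dots> = real n"
    by (subst sum_lessThan_telescope)
      (simp add: almost_geodesic_vec lattice_ray_height[OF u V])
  finally have e: "(\<Sum>i<length w. 1 - ?e i) \<le> B" using B by (simp add: sum_subtractf)
  have balance: "(\<Sum>i<length w. ?e i * (((?l i)\<^sup>2 - ?m i) + ((?l (Suc i))\<^sup>2 - ?m (Suc i)))) = 0"
    using excess_sum_cong[OF w, of u V] excess_sum_ray[of n] by (simp only: excess_sum_def excess_def)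
  have step: "\<bar>?l (Suc i) - ?l i\<bar> \<le> 1" if "i < length w" for i
    using cross2_letter[OF u] that by (simp add: word_vec_take_Suc)
  have e1: "?e i \<le> 1" for i using height_letter[of u "w ! i"] by auto
  have m: "?m i \<le> (?l i)\<^sup>2" for i using excess_nonneg[of "take i w"] by (simp add: excess_def)
  show "j \<le> length w \<Longrightarrow> ?level"
    by (rule almost_forward_bound(1)[of "length w" ?e B ?l ?m])
      (use e balance step e1 m lattice_ray_level_sq[OF u V] in auto)
  show ?excess
    unfolding excess_def
    by (rule almost_forward_bound(2)[of "length w" ?e B ?l ?m])
      (use e balance step e1 m lattice_ray_level_sq[OF u V] in auto)
qed

end

end

section \<open>Busemann functions of word metrics\<close>

context group
begin

lemma horo_action_mult:
  assumes "g \<in> carrier G" "h \<in> carrier G"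
  shows "horo_action G (g \<otimes> h) \<phi> = horo_action G g (horo_action G h \<phi>)"
  using assms by (auto simp: horo_action_def inv_mult_group m_assoc restrict_def fun_eq_iff)

lemma horo_action_one:
  assumes "\<phi> \<in> extensional (carrier G)" "\<phi> \<one> = 0"
  shows "horo_action G \<one> \<phi> = \<phi>"
  using assms by (auto simp: horo_action_def fun_eq_iff extensional_def)

text \<open>Vanishing at the identity is a closed condition, satisfied by every
  \<open>dist_fun\<close>. The action subtracts a base value, so the identity element fixes only
  such normalized functions.\<close>

lemma horoboundary_normalized:
  assumes "\<phi> \<in> horoboundary G S"
  shows "\<phi> \<in> extensional (carrier G)" "\<phi> \<one> = 0"
proof -
  let ?X = "product_topology (\<lambda>_. euclideanreal) (carrier G)"
  have "closedin ?X {f \<in> topspace ?X. f \<one> \<in> {0 :: real}}"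
    by (rule closedin_continuous_map_preimage[of _ euclideanreal])
      (auto intro: continuous_map_product_projection)
  moreover have "dist_fun G S ` carrier G \<subseteq> {f \<in> topspace ?X. f \<one> \<in> {0 :: real}}"
    by (auto simp: dist_fun_def)
  ultimately have "?X closure_of (dist_fun G S ` carrier G) \<subseteq> {f \<in> topspace ?X. f \<one> \<in> {0 :: real}}"
    by (rule closure_of_minimal[rotated])
  then show "\<phi> \<in> extensional (carrier G)" "\<phi> \<one> = 0"
    using assms by (auto simp: horoboundary_def PiE_def)
qed

lemma subgroup_stabilizer_reduced_action:
  assumes A: "A \<subseteq> horoboundary G S"
  shows "subgroup (stabilizer G (reduced_action G) A) G"
proof
  have one: "reduced_action G \<one> A = A"
  proof -
    have "horo_action G \<one> \<phi> = \<phi>" if "\<phi> \<in> A" for \<phi>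
      using horo_action_one horoboundary_normalized[of \<phi> S] A that by blast
    then show ?thesis by (simp add: reduced_action_def)
  qed
  have mult: "reduced_action G (g \<otimes> h) Y = reduced_action G g (reduced_action G h Y)"
    if "g \<in> carrier G" "h \<in> carrier G" for g h Y
    using horo_action_mult[OF that] by (simp add: reduced_action_def image_image)
  show "stabilizer G (reduced_action G) A \<subseteq> carrier G"
    by (auto simp: stabilizer_def)
  show "\<one> \<in> stabilizer G (reduced_action G) A"
    using one by (simp add: stabilizer_def)
  show "g \<otimes> h \<in> stabilizer G (reduced_action G) A"
    if "g \<in> stabilizer G (reduced_action G) A" "h \<in> stabilizer G (reduced_action G) A" for g h
    using that mult by (simp add: stabilizer_def)
  show "inv g \<in> stabilizer G (reduced_action G) A"
    if "g \<in> stabilizer G (reduced_action G) A" for g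
  proof -
    have g: "g \<in> carrier G" "reduced_action G g A = A"
      using that by (simp_all add: stabilizer_def)
    have "reduced_action G (inv g) A = reduced_action G (inv g \<otimes> g) A"
      using mult[of "inv g" g A] g by simp
    then show ?thesis using one g(1) by (simp add: stabilizer_def)
  qed
qed

end

lemma bounded_diff_refl: "\<phi> \<in> horoboundary G S \<Longrightarrow> (\<phi>, \<phi>) \<in> bounded_diff G S"
  by (auto simp: bounded_diff_def)

lemma horo_class_eqD:
  assumes "\<phi> \<in> horoboundary G S" "\<psi> \<in> horoboundary G S" "horo_class G S \<phi> = horo_class G S \<psi>"
  shows "\<exists>K. \<forall>h\<in>carrier G. \<bar>\<phi> h - \<psi> h\<bar> \<le> K"
proof -
  have "\<psi> \<in> horo_class G S \<phi>"
    using assms bounded_diff_refl[OF assms(2)] by (auto simp: horo_class_def)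
  then show ?thesis by (auto simp: horo_class_def bounded_diff_def)
qed

lemma stabilizer_horo_classD:
  assumes "\<phi> \<in> horoboundary G S" "g \<in> stabilizer G (reduced_action G) (horo_class G S \<phi>)"
  shows "\<exists>K. \<forall>h\<in>carrier G. \<bar>\<phi> h - horo_action G g \<phi> h\<bar> \<le> K"
proof -
  have "\<phi> \<in> horo_class G S \<phi>"
    using bounded_diff_refl[OF assms(1)] by (auto simp: horo_class_def)
  then have "horo_action G g \<phi> \<in> horo_class G S \<phi>"
    using assms(2) by (auto simp: stabilizer_def reduced_action_def)
  then show ?thesis by (auto simp: horo_class_def bounded_diff_def)
qed

section \<open>Word length for a symmetric generating set\<close>

locale generated_group = group G for G (structure) +
  fixes S :: "'a set"
  assumes gens_carrier: "S \<subseteq> carrier G"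
    and gens_inv: "s \<in> S \<Longrightarrow> inv s \<in> S"
    and gens_generate: "g \<in> carrier G \<Longrightarrow> \<exists>ws. set ws \<subseteq> S \<and> foldr (\<otimes>) ws \<one> = g"
begin

lemma foldr_mult_closed: "set ws \<subseteq> S \<Longrightarrow> foldr (\<otimes>) ws \<one> \<in> carrier G"
  using gens_carrier by (induction ws) auto

lemma foldr_mult_append:
  "set vs \<subseteq> S \<Longrightarrow> set ws \<subseteq> S \<Longrightarrow>
    foldr (\<otimes>) (vs @ ws) \<one> = foldr (\<otimes>) vs \<one> \<otimes> foldr (\<otimes>) ws \<one>"
proof (induction vs)
  case (Cons v vs)
  then show ?case
    using gens_carrier foldr_mult_closed[of vs] foldr_mult_closed[of ws]
      m_assoc[of v "foldr (\<otimes>) vs \<one>" "foldr (\<otimes>) ws \<one>"] by (auto simp del: foldr_append)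
qed (simp add: foldr_mult_closed del: foldr_append)

lemma foldr_mult_inverse:
  "set ws \<subseteq> S \<Longrightarrow> foldr (\<otimes>) (rev (map (\<lambda>s. inv s) ws)) \<one> = inv (foldr (\<otimes>) ws \<one>)"
proof (induction ws)
  case (Cons w ws)
  have w: "w \<in> carrier G" "inv w \<in> S" using Cons.prems gens_carrier gens_inv by auto
  have "foldr (\<otimes>) (rev (map (\<lambda>s. inv s) ws) @ [inv w]) \<one> = inv (foldr (\<otimes>) ws \<one>) \<otimes> inv w"
    using Cons w gens_inv by (subst foldr_mult_append) auto
  then show ?case using w foldr_mult_closed[of ws] Cons.prems by (simp add: inv_mult_group del: foldr_append)
qed simp

lemma word_length_le: "set ws \<subseteq> S \<Longrightarrow> word_length G S (foldr (\<otimes>) ws \<one>) \<le> length ws"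
  unfolding word_length_def by (rule Least_le) auto

lemma word_length_attained:
  assumes "g \<in> carrier G"
  obtains ws where "set ws \<subseteq> S" "foldr (\<otimes>) ws \<one> = g" "length ws = word_length G S g"
proof -
  have "\<exists>n ws. length ws = n \<and> set ws \<subseteq> S \<and> foldr (\<otimes>) ws \<one> = g"
    using gens_generate[OF assms] by blast
  then have "\<exists>ws. length ws = word_length G S g \<and> set ws \<subseteq> S \<and> foldr (\<otimes>) ws \<one> = g"
    unfolding word_length_def by (rule LeastI_ex)
  then show ?thesis using that by blast
qed

lemma word_length_one: "word_length G S \<one> = 0"
  using word_length_le[of "[]"] by simp

lemma word_length_gen: "s \<in> S \<Longrightarrow> word_length G S s \<le> 1"
  using word_length_le[of "[s]"] gens_carrier by auto

lemma word_length_mult: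
  assumes "g \<in> carrier G" "h \<in> carrier G"
  shows "word_length G S (g \<otimes> h) \<le> word_length G S g + word_length G S h"
proof -
  obtain vs where vs: "set vs \<subseteq> S" "foldr (\<otimes>) vs \<one> = g" "length vs = word_length G S g"
    using word_length_attained[OF assms(1)] .
  obtain ws where ws: "set ws \<subseteq> S" "foldr (\<otimes>) ws \<one> = h" "length ws = word_length G S h"
    using word_length_attained[OF assms(2)] .
  show ?thesis
    using word_length_le[of "vs @ ws"] foldr_mult_append[OF vs(1) ws(1)] vs ws by (simp del: foldr_append)
qed

lemma word_length_inv:
  assumes "g \<in> carrier G"
  shows "word_length G S (inv g) = word_length G S g"
proof -
  have le: "word_length G S (inv g) \<le> word_length G S g" if g: "g \<in> carrier G" for g
  proof -
    obtain ws where ws: "set ws \<subseteq> S" "foldr (\<otimes>) ws \<one> = g" "length ws = word_length G S g"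
      using word_length_attained[OF g] .
    have "set (rev (map (\<lambda>s. inv s) ws)) \<subseteq> S" using ws(1) gens_inv by auto
    from word_length_le[OF this] show ?thesis using foldr_mult_inverse[OF ws(1)] ws by simp
  qed
  show ?thesis using le[OF assms] le[of "inv g"] assms by simp
qed

end

section \<open>Geodesic rays and their Busemann functions\<close>

locale geodesic_ray = generated_group +
  fixes \<gamma> :: "nat \<Rightarrow> 'a"
  assumes ray_0: "\<gamma> 0 = \<one>"
    and ray_Suc: "\<exists>s\<in>S. \<gamma> (Suc n) = \<gamma> n \<otimes> s"
    and ray_length: "n \<le> word_length G S (\<gamma> n)"
begin

lemma ray_carrier [simp]: "\<gamma> n \<in> carrier G"
proof (induction n)
  case (Suc n)
  then show ?case using ray_Suc[of n] gens_carrier by auto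
qed (simp add: ray_0)

lemma ray_dist_Suc:
  assumes "h \<in> carrier G"
  shows "word_length G S (inv (\<gamma> (Suc n)) \<otimes> h) \<le> Suc (word_length G S (inv (\<gamma> n) \<otimes> h))"
proof -
  obtain s where s: "s \<in> S" "\<gamma> (Suc n) = \<gamma> n \<otimes> s" using ray_Suc by blast
  have "s \<in> carrier G" using s gens_carrier by auto
  then have "inv (\<gamma> (Suc n)) \<otimes> h = inv s \<otimes> (inv (\<gamma> n) \<otimes> h)"
    using s assms by (simp add: inv_mult_group m_assoc)
  then show ?thesis
    using word_length_mult[of "inv s" "inv (\<gamma> n) \<otimes> h"] word_length_gen[OF gens_inv[OF s(1)]]
      \<open>s \<in> carrier G\<close> assms by simp
qed

lemma ray_dist_le: "word_length G S (inv (\<gamma> (k + n)) \<otimes> \<gamma> k) \<le> n"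
proof (induction n)
  case (Suc n)
  then show ?case using ray_dist_Suc[of "\<gamma> k" "k + n"] by simp
qed (simp add: word_length_one)

lemma ray_dist_ge:
  assumes "h \<in> carrier G"
  shows "n \<le> word_length G S (inv (\<gamma> n) \<otimes> h) + word_length G S h"
proof -
  have "(inv (\<gamma> n) \<otimes> h) \<otimes> inv h = inv (\<gamma> n)" using assms by (simp add: m_assoc)
  then show ?thesis
    using word_length_mult[of "inv (\<gamma> n) \<otimes> h" "inv h"] ray_length[of n] assms
    by (simp add: word_length_inv)
qed

lemma ray_length_eq: "word_length G S (\<gamma> n) = n"
  using ray_dist_le[of 0 n] ray_length[of n] by (simp add: ray_0 word_length_inv)

lemma dist_fun_ray:
  "h \<in> carrier G \<Longrightarrow> dist_fun G S (\<gamma> n) h = real (word_length G S (inv (\<gamma> n) \<otimes> h)) - real n"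
  by (simp add: dist_fun_def word_dist_def word_length_inv ray_length_eq)

text \<open>One step along the ray increases the distance to \<open>h\<close> by at most one, while
  the subtracted length grows by exactly one. Together with the lower bound from
  \<open>ray_dist_ge\<close> this makes the Busemann limit exist.\<close>

lemma dist_fun_ray_decseq:
  assumes "h \<in> carrier G"
  shows "decseq (\<lambda>n. dist_fun G S (\<gamma> n) h)"
proof (rule decseq_SucI)
  fix n
  show "dist_fun G S (\<gamma> (Suc n)) h \<le> dist_fun G S (\<gamma> n) h"
    using ray_dist_Suc[OF assms, of n] by (simp add: dist_fun_ray[OF assms])
qed

lemma busemann_LIMSEQ:
  assumes "h \<in> carrier G"
  shows "(\<lambda>n. dist_fun G S (\<gamma> n) h) \<longlonglongrightarrow> busemann G S \<gamma> h"
proof -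
  have "- real (word_length G S h) \<le> dist_fun G S (\<gamma> n) h" for n
    using ray_dist_ge[OF assms, of n] by (simp add: dist_fun_ray[OF assms])
  then obtain L where L: "(\<lambda>n. dist_fun G S (\<gamma> n) h) \<longlonglongrightarrow> L"
    using decseq_convergent[OF dist_fun_ray_decseq[OF assms]] by metis
  then show ?thesis using limI[OF L] assms by (simp add: busemann_def)
qed

text \<open>The summand 1 is the slack for passing from the limit to a finite stage.\<close>

lemma busemann_le_imp_dist_le:
  assumes h: "h \<in> carrier G" and le: "busemann G S \<gamma> h \<le> c"
  shows "\<exists>n. real (word_length G S (inv (\<gamma> n) \<otimes> h)) \<le> real n + c + 1"
proof -
  have "eventually (\<lambda>n. dist_fun G S (\<gamma> n) h < c + 1) sequentially"
    using order_tendstoD(2)[OF busemann_LIMSEQ[OF h]] le by simp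
  then obtain n where "dist_fun G S (\<gamma> n) h < c + 1"
    by (auto simp: eventually_sequentially)
  then show ?thesis by (intro exI[of _ n]) (simp add: dist_fun_ray[OF h])
qed

lemma busemann_ray: "busemann G S \<gamma> (\<gamma> k) = - real k"
proof (rule LIMSEQ_unique[OF busemann_LIMSEQ])
  have "dist_fun G S (\<gamma> n) (\<gamma> k) = - real k" if "n \<ge> k" for n
    using ray_dist_le[of k "n - k"] ray_dist_ge[of "\<gamma> k" n] that
    by (simp add: dist_fun_ray ray_length_eq)
  then show "(\<lambda>n. dist_fun G S (\<gamma> n) (\<gamma> k)) \<longlonglongrightarrow> - real k"
    by (intro tendsto_eventually eventually_sequentiallyI[of k])
qed simp

text \<open>A function \<open>dist_fun G S g\<close> is bounded below by minus the length of
  \<open>g\<close>, whereas the Busemann function tends to minus infinity along its own ray.\<close>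

lemma busemann_in_horoboundary: "busemann G S \<gamma> \<in> horoboundary G S"
proof -
  let ?X = "product_topology (\<lambda>_. euclideanreal) (carrier G)"
  have "limitin ?X (\<lambda>n. dist_fun G S (\<gamma> n)) (busemann G S \<gamma>) sequentially"
    unfolding limitin_componentwise using busemann_LIMSEQ
    by (auto simp: busemann_def dist_fun_def)
  moreover have "dist_fun G S ` carrier G \<subseteq> topspace ?X" by (auto simp: dist_fun_def)
  then have "dist_fun G S (\<gamma> n) \<in> ?X closure_of (dist_fun G S ` carrier G)" for n
    by (rule subsetD[OF closure_of_subset imageI[OF ray_carrier]])
  then have "eventually (\<lambda>n. dist_fun G S (\<gamma> n) \<in> ?X closure_of (dist_fun G S ` carrier G)) sequentially"
    by (intro always_eventually allI)
  ultimately have "busemann G S \<gamma> \<in> ?X closure_of (dist_fun G S ` carrier G)"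
    by (rule limitin_closedin[OF _ closedin_closure_of]) simp
  moreover have "busemann G S \<gamma> \<noteq> dist_fun G S g" if g: "g \<in> carrier G" for g
  proof
    assume eq: "busemann G S \<gamma> = dist_fun G S g"
    have "- real (word_length G S g) \<le> dist_fun G S g h" if "h \<in> carrier G" for h
      using that g by (simp add: dist_fun_def word_dist_def word_length_inv)
    then have "- real (word_length G S g) \<le> busemann G S \<gamma> (\<gamma> (Suc (word_length G S g)))"
      unfolding eq by simp
    then show False by (simp add: busemann_ray)
  qed
  ultimately show ?thesis by (auto simp: horoboundary_def)
qed

end

section \<open>Rays of the Cartan group\<close>

lemma generated_group_Cartan: "generated_group Cartan cartan_gens"
proof -
  interpret group Cartan by (rule group_Cartan)
  show ?thesis
  proof
    show "cartan_gens \<subseteq> carrier Cartan" by (auto simp: cartan_gens_eq)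
    show "inv\<^bsub>Cartan\<^esub> s \<in> cartan_gens" if "s \<in> cartan_gens" for s
      using that word_elt_inv_letter by (auto simp: cartan_gens_eq simp flip: word_elt_inv_letter)
    fix g assume "g \<in> carrier Cartan"
    then obtain w where "g = word_elt w" by (rule word_elt_surj)
    then have "set (map (\<lambda>a. word_elt [a]) w) \<subseteq> cartan_gens
      \<and> foldr (\<otimes>\<^bsub>Cartan\<^esub>) (map (\<lambda>a. word_elt [a]) w) \<one>\<^bsub>Cartan\<^esub> = g"
      unfolding foldr_word_elt cartan_gens_eq by auto
    then show "\<exists>ws. set ws \<subseteq> cartan_gens \<and> foldr (\<otimes>\<^bsub>Cartan\<^esub>) ws \<one>\<^bsub>Cartan\<^esub> = g" by blast
  qed
qed

lemma Cartan_word_length_attained: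
  assumes "g \<in> carrier Cartan"
  obtains w where "word_elt w = g" "length w = word_length Cartan cartan_gens g"
proof -
  interpret generated_group Cartan cartan_gens by (rule generated_group_Cartan)
  obtain ws where ws: "set ws \<subseteq> cartan_gens" "foldr (\<otimes>\<^bsub>Cartan\<^esub>) ws \<one>\<^bsub>Cartan\<^esub> = g"
    "length ws = word_length Cartan cartan_gens g"
    using word_length_attained[OF assms] .
  have "ws \<in> range (map (\<lambda>a. word_elt [a]))"
    using ws(1) unfolding cartan_gens_eq by (simp add: ex_map_conv subset_iff image_iff set_eq_iff)
  then obtain w where "ws = map (\<lambda>a. word_elt [a]) w" by blast
  then show ?thesis using that[of w] ws foldr_word_elt by simp
qed

lemma cartan_ray_word:
  assumes "cartan_ray u \<gamma>"
  obtains a where "\<And>n. \<gamma> n = word_elt (map a [0..<n])"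
proof -
  have "\<exists>l. \<gamma> (Suc n) = \<gamma> n \<otimes>\<^bsub>Cartan\<^esub> word_elt [l]" for n
    using assms unfolding cartan_ray_def cartan_gens_eq by blast
  then obtain a where a: "\<And>n. \<gamma> (Suc n) = \<gamma> n \<otimes>\<^bsub>Cartan\<^esub> word_elt [a n]" by metis
  have "\<gamma> n = word_elt (map a [0..<n])" for n
  proof (induction n)
    case 0
    then show ?case using assms by (simp add: cartan_ray_def word_elt_Nil)
  next
    case (Suc n)
    then show ?case using a[of n] by (simp add: word_elt_append)
  qed
  then show ?thesis by (rule that)
qed

lemma cartan_ray_lattice: "cartan_ray u \<gamma> \<Longrightarrow> lattice_ray u (\<lambda>n. cartan_ab (\<gamma> n))"
  by (simp add: cartan_ray_def)

context
  fixes u :: "real \<times> real" and \<gamma> :: "nat \<Rightarrow> cartan"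
  assumes u: "u \<in> sphere 0 1" and ray: "cartan_ray u \<gamma>"
begin

text \<open>A word spelling \<open>\<gamma> n\<close> has height \<open>n\<close>, and each letter
  raises the height by at most one.\<close>

lemma geodesic_cartan_ray: "geodesic_ray Cartan cartan_gens \<gamma>"
proof -
  interpret generated_group Cartan cartan_gens by (rule generated_group_Cartan)
  obtain a where a: "\<And>n. \<gamma> n = word_elt (map a [0..<n])" using cartan_ray_word[OF ray] by blast
  show ?thesis
  proof
    show "\<gamma> 0 = \<one>\<^bsub>Cartan\<^esub>" "\<exists>s\<in>cartan_gens. \<gamma> (Suc n) = \<gamma> n \<otimes>\<^bsub>Cartan\<^esub> s" for n
      using ray by (simp_all add: cartan_ray_def)
    fix n
    have "\<gamma> n \<in> carrier Cartan" by (simp add: a)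
    then obtain w where w: "word_elt w = \<gamma> n" "length w = word_length Cartan cartan_gens (\<gamma> n)"
      by (rule Cartan_word_length_attained)
    have "height u (word_vec w) = real n"
      using lattice_ray_height[OF u cartan_ray_lattice[OF ray], of n]
      unfolding w(1)[symmetric] cartan_ab_word_elt .
    then show "n \<le> word_length Cartan cartan_gens (\<gamma> n)"
      using height_word[of u w] w(2) by simp
  qed
qed

text \<open>Translates bounds on Busemann functions into almost geodesics: \<open>w\<close> is
  continued by a shortest word \<open>v\<close> from its endpoint to a suitable vertex of the
  ray.\<close>

lemma busemann_le_imp_almost_geodesic:
  assumes "busemann Cartan cartan_gens \<gamma> (word_elt w) \<le> K - real (length w)"
  obtains v n where "word_elt (w @ v) = \<gamma> n" "real (length (w @ v)) \<le> real n + (K + 1)"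
proof -
  interpret geodesic_ray Cartan cartan_gens \<gamma> by (rule geodesic_cartan_ray)
  obtain n where n: "real (word_length Cartan cartan_gens (inv\<^bsub>Cartan\<^esub> \<gamma> n \<otimes>\<^bsub>Cartan\<^esub> word_elt w))
      \<le> real n + (K - real (length w)) + 1"
    using busemann_le_imp_dist_le[OF word_elt_carrier assms] by blast
  let ?g = "inv\<^bsub>Cartan\<^esub> word_elt w \<otimes>\<^bsub>Cartan\<^esub> \<gamma> n"
  have "?g = inv\<^bsub>Cartan\<^esub> (inv\<^bsub>Cartan\<^esub> \<gamma> n \<otimes>\<^bsub>Cartan\<^esub> word_elt w)"
    by (simp add: inv_mult_group)
  then have len: "word_length Cartan cartan_gens ?g
      = word_length Cartan cartan_gens (inv\<^bsub>Cartan\<^esub> \<gamma> n \<otimes>\<^bsub>Cartan\<^esub> word_elt w)"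
    by (simp add: word_length_inv)
  have "?g \<in> carrier Cartan" by simp
  then obtain v where v: "word_elt v = ?g" "length v = word_length Cartan cartan_gens ?g"
    by (rule Cartan_word_length_attained)
  have "word_elt (w @ v) = \<gamma> n"
    by (simp add: word_elt_append v(1) flip: m_assoc)
  then show ?thesis using that[of v n] n len v(2) by simp
qed

end

text \<open>Bounded level relative to \<open>u'\<close> makes the two directions parallel, and the
  lower bound on the height excludes opposite ones.\<close>

lemma bounded_rays_eq:
  assumes u: "u \<in> sphere 0 1" and u': "u' \<in> sphere 0 1" and V: "lattice_ray u V"
    and level: "\<And>k. \<bar>cross2 u' (V k)\<bar> \<le> D" and height: "\<And>k. - B \<le> height u' (V k)"
  shows "u = u'"
proof -
  define c where "c = cross2 u u'"
  \<comment> \<open>The first condition contradicts \<open>u' = - u\<close>; the second contradicts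
    the bounded levels unless \<open>c = 0\<close>.\<close>
  obtain k :: nat where k: "real k > B" "real k * \<bar>c\<bar> > \<bar>height u u'\<bar> + \<bar>height u u\<bar> * D \<or> c = 0"
  proof (cases "c = 0")
    case True
    then show ?thesis using that reals_Archimedean2[of B] by blast
  next
    case False
    obtain k :: nat where k: "max B ((\<bar>height u u'\<bar> + \<bar>height u u\<bar> * D) / \<bar>c\<bar>) < real k"
      using reals_Archimedean2 by blast
    then have "\<bar>height u u'\<bar> + \<bar>height u u\<bar> * D < real k * \<bar>c\<bar>"
      using False by (simp add: pos_divide_less_eq)
    then show ?thesis using k by (intro that[of k]) auto
  qed
  \<comment> \<open>Cramer's rule without division, hence valid also for parallel \<open>u\<close>
    and \<open>u'\<close>. Taking heights turns it into a formula for
    \<open>c * real k\<close>.\<close>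
  have "c *\<^sub>R V k = cross2 u (V k) *\<^sub>R u' - cross2 u' (V k) *\<^sub>R u"
    by (cases u; cases u'; cases "V k") (simp add: c_def cross2_def algebra_simps)
  then have "c * real k = cross2 u (V k) * height u u' - cross2 u' (V k) * height u u"
    using lattice_ray_height[OF u V, of k] by (metis height_simps(4,5))
  then have "\<bar>c\<bar> * real k = \<bar>cross2 u (V k) * height u u' - cross2 u' (V k) * height u u\<bar>"
    by (metis abs_mult abs_of_nat)
  also have "\<dots> \<le> \<bar>cross2 u (V k)\<bar> * \<bar>height u u'\<bar> + \<bar>cross2 u' (V k)\<bar> * \<bar>height u u\<bar>"
    by (metis abs_mult abs_triangle_ineq4)
  also have "\<dots> \<le> 1 * \<bar>height u u'\<bar> + D * \<bar>height u u\<bar>"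
    using lattice_ray_level[OF u V] level by (intro add_mono mult_right_mono) auto
  finally have "c = 0" using k(2) by (auto simp: mult.commute)
  obtain x y where xy: "u = (x, y)" by force
  obtain x' y' where xy': "u' = (x', y')" by force
  have n: "x\<^sup>2 + y\<^sup>2 = 1" "x'\<^sup>2 + y'\<^sup>2 = 1" "x * y' = y * x'"
    using u u' \<open>c = 0\<close> unfolding sphere_prod_eq by (simp_all add: xy xy' c_def cross2_def)
  \<comment> \<open>Lagrange's identity: parallel unit vectors have inner product 1 or -1.\<close>
  have "(x * x' + y * y')\<^sup>2 = (x\<^sup>2 + y\<^sup>2) * (x'\<^sup>2 + y'\<^sup>2) - (x * y' - y * x')\<^sup>2"
    by (simp add: power2_eq_square algebra_simps)
  then have "(x * x' + y * y')\<^sup>2 = 1" using n by simp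
  then consider "x * x' + y * y' = 1" | "x * x' + y * y' = -1" by (auto simp: power2_eq_1_iff)
  then show ?thesis
  proof cases
    case 1
    have "(x - x')\<^sup>2 + (y - y')\<^sup>2 = (x\<^sup>2 + y\<^sup>2) + (x'\<^sup>2 + y'\<^sup>2) - 2 * (x * x' + y * y')"
      by (simp add: power2_eq_square algebra_simps)
    then have "(x - x')\<^sup>2 + (y - y')\<^sup>2 = 0" using n 1 by simp
    then show ?thesis by (simp add: xy xy' sum_power2_eq_zero_iff)
  next
    case 2
    have "(x + x')\<^sup>2 + (y + y')\<^sup>2 = (x\<^sup>2 + y\<^sup>2) + (x'\<^sup>2 + y'\<^sup>2) + 2 * (x * x' + y * y')"
      by (simp add: power2_eq_square algebra_simps)
    then have "(x + x')\<^sup>2 + (y + y')\<^sup>2 = 0" using n 2 by simp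
    then have "x' = - x" "y' = - y" by (simp_all add: sum_power2_eq_zero_iff)
    then have "height u' (V k) = - height u (V k)"
      by (simp add: xy xy' height_def sgn_minus)
    then show ?thesis using height[of k] lattice_ray_height[OF u V, of k] k(1) by simp
  qed
qed

text \<open>The value at \<open>\<gamma> k\<close> is \<open>- real k\<close> for
  \<open>\<gamma>\<close>, hence at most \<open>K - real k\<close> for \<open>\<gamma>'\<close>. So
  the first \<open>k\<close> steps of \<open>\<gamma>\<close> extend to an almost geodesic ending on
  \<open>\<gamma>'\<close>, with constants independent of \<open>k\<close>.\<close>

lemma busemann_bounded_diff_eq:
  assumes u: "u \<in> sphere 0 1" and \<gamma>: "cartan_ray u \<gamma>"
    and u': "u' \<in> sphere 0 1" and \<gamma>': "cartan_ray u' \<gamma>'"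
    and K: "\<And>h. h \<in> carrier Cartan \<Longrightarrow>
      \<bar>busemann Cartan cartan_gens \<gamma> h - busemann Cartan cartan_gens \<gamma>' h\<bar> \<le> K"
  shows "u = u'"
proof (rule bounded_rays_eq[OF u u' cartan_ray_lattice[OF \<gamma>]])
  obtain a where a: "\<And>n. \<gamma> n = word_elt (map a [0..<n])" using cartan_ray_word[OF \<gamma>] by blast
  obtain a' where a': "\<And>n. \<gamma>' n = word_elt (map a' [0..<n])" using cartan_ray_word[OF \<gamma>'] by blast
  fix k
  let ?w = "map a [0..<k]"
  have "busemann Cartan cartan_gens \<gamma> (word_elt ?w) = - real k"
    using geodesic_ray.busemann_ray[OF geodesic_cartan_ray[OF u \<gamma>], of k] a by simp
  then have "busemann Cartan cartan_gens \<gamma>' (word_elt ?w) \<le> K - real (length ?w)"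
    using K[of "word_elt ?w"] by simp
  then obtain v n where v: "word_elt (?w @ v) = \<gamma>' n" "real (length (?w @ v)) \<le> real n + (K + 1)"
    by (rule busemann_le_imp_almost_geodesic[OF u' \<gamma>'])
  note ctx = u' cartan_ray_lattice[OF \<gamma>']
  have vec: "word_vec (map a' [0..<n]) = cartan_ab (\<gamma>' n)" for n
    by (simp add: a' cartan_ab_word_elt)
  have k: "k \<le> length (?w @ v)" "word_vec (take k (?w @ v)) = cartan_ab (\<gamma> k)"
    by (simp_all add: a cartan_ab_word_elt)
  show "\<bar>cross2 u' (cartan_ab (\<gamma> k))\<bar> \<le> 16 * (K + 1) + 2"
    using almost_geodesic_level[OF ctx vec v(1)[unfolded a'] v(2) k(1)] k(2) by simp
  show "- (K + 1) \<le> height u' (cartan_ab (\<gamma> k))"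
    using almost_geodesic_height[OF ctx vec v(1)[unfolded a'] v(2) k(1)] k(2) by simp
qed

section \<open>Stabilizers of the classes\<close>

lemma sphere_cross2_eq_0:
  assumes "u \<in> sphere 0 1" "cross2 u z = 0"
  shows "\<exists>t. z = t *\<^sub>R u"
proof -
  obtain x y where u: "u = (x, y)" by force
  obtain r s where z: "z = (r, s)" by force
  have *: "x\<^sup>2 + y\<^sup>2 = 1" "x * s = y * r"
    using assms unfolding sphere_prod_eq by (simp_all add: u z cross2_def)
  \<comment> \<open>A vector of level zero is its own orthogonal projection to the line of
    \<open>u\<close>, so the coefficient is the inner product \<open>x * r + y * s\<close>.\<close>
  have "r = (x\<^sup>2 + y\<^sup>2) * r" "s = (x\<^sup>2 + y\<^sup>2) * s" using * by simp_all
  moreover have "(x\<^sup>2 + y\<^sup>2) * r = (x * r + y * s) * x - y * (x * s - y * r)"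
    "(x\<^sup>2 + y\<^sup>2) * s = (x * r + y * s) * y + x * (x * s - y * r)"
    by (simp_all add: power2_eq_square algebra_simps)
  ultimately have "r = (x * r + y * s) * x" "s = (x * r + y * s) * y"
    using *(2) by simp_all
  then show ?thesis unfolding u z by (intro exI[of _ "x * r + y * s"]) simp
qed

lemma cartan_ab_pow:
  assumes "g \<in> carrier Cartan"
  shows "cartan_ab (g [^]\<^bsub>Cartan\<^esub> (n :: nat)) = real n *\<^sub>R cartan_ab g"
proof -
  interpret group Cartan by (rule group_Cartan)
  show ?thesis
    using assms by (induction n) (simp_all add: cartan_ab_one cartan_ab_mult algebra_simps)
qed

text \<open>If \<open>g\<close> has level at least 3, then an almost geodesic running along \<open>g \<otimes> \<gamma> k\<close> collects an excess of
  at least 1 at each of its vertices there, which exceeds the bound on the total for large \<open>k\<close>.\<close>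

lemma stabilizer_busemann_level:
  assumes u: "u \<in> sphere 0 1" and \<gamma>: "cartan_ray u \<gamma>"
    and g: "g \<in> stabilizer Cartan (reduced_action Cartan)
      (horo_class Cartan cartan_gens (busemann Cartan cartan_gens \<gamma>))"
  shows "\<bar>cross2 u (cartan_ab g)\<bar> < 3"
proof (rule ccontr)
  assume big: "\<not> \<bar>cross2 u (cartan_ab g)\<bar> < 3"
  interpret geodesic_ray Cartan cartan_gens \<gamma> by (rule geodesic_cartan_ray[OF u \<gamma>])
  let ?b = "busemann Cartan cartan_gens \<gamma>"
  let ?V = "\<lambda>n. cartan_ab (\<gamma> n)"
  have gG: "g \<in> carrier Cartan" using g by (simp add: stabilizer_def)
  obtain p where p: "g = word_elt p" using gG by (rule word_elt_surj)
  obtain a where a: "\<And>n. \<gamma> n = word_elt (map a [0..<n])" using cartan_ray_word[OF \<gamma>] by blast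
  note ctx = u cartan_ray_lattice[OF \<gamma>]
  have vec: "word_vec (map a [0..<n]) = cartan_ab (\<gamma> n)" for n
    by (simp add: a cartan_ab_word_elt)
  obtain K where K: "\<And>h. h \<in> carrier Cartan \<Longrightarrow> \<bar>?b h - horo_action Cartan g ?b h\<bar> \<le> K"
    using stabilizer_horo_classD[OF busemann_in_horoboundary g] by blast
  \<comment> \<open>The summands pay for the bounded difference, the normalization in the action,
    the initial segment from the identity to \<open>g\<close>, and the passage to a finite
    stage.\<close>
  define B where "B = K - ?b (inv\<^bsub>Cartan\<^esub> g) + real (length p) + 1"
  have bound: "real k \<le> 2 * B * (16 * B + 2)\<^sup>2" for k
  proof -
    let ?w = "p @ map a [0..<k]"
    have w: "word_elt ?w = g \<otimes>\<^bsub>Cartan\<^esub> \<gamma> k" by (simp add: word_elt_append p a)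
    have "inv\<^bsub>Cartan\<^esub> g \<otimes>\<^bsub>Cartan\<^esub> (g \<otimes>\<^bsub>Cartan\<^esub> \<gamma> k) = \<gamma> k"
      using gG by (simp flip: m_assoc)
    then have "horo_action Cartan g ?b (word_elt ?w) = - real k - ?b (inv\<^bsub>Cartan\<^esub> g)"
      using gG busemann_ray[of k] unfolding w by (simp add: horo_action_def)
    then have "?b (word_elt ?w) \<le> (B - 1) - real (length ?w)"
      using K[OF word_elt_carrier[of ?w]] by (simp add: B_def)
    then obtain v n where v: "word_elt (?w @ v) = \<gamma> n" "real (length (?w @ v)) \<le> real n + ((B - 1) + 1)"
      by (rule busemann_le_imp_almost_geodesic[OF u \<gamma>])
    define x where "x i = excess u ?V (word_vec (take i (?w @ v)))" for i
    have "1 \<le> x (length p + j)" if "j < k" for j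
    proof -
      have "word_vec (take (length p + j) (?w @ v)) = cartan_ab g + ?V j"
        using that by (simp add: p a cartan_ab_word_elt take_map)
      \<comment> \<open>The level is at least 3 for \<open>g\<close> and at most 1 in absolute value
        on the ray, so the excess is at least \<open>4 - 1 / 2\<close>.\<close>
      moreover have "2 \<le> \<bar>cross2 u (cartan_ab g + ?V j)\<bar>"
        using big lattice_ray_level[OF ctx, of j] by simp
      then have "2\<^sup>2 \<le> (cross2 u (cartan_ab g + ?V j))\<^sup>2"
        by (simp only: abs_le_square_iff[symmetric] abs_numeral)
      then have "4 \<le> (cross2 u (cartan_ab g + ?V j))\<^sup>2" by simp
      ultimately show ?thesis
        using lattice_ray_level_sq[OF ctx, of "nat \<bar>\<lfloor>height u (cartan_ab g + ?V j)\<rfloor>\<bar>"]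
        by (simp only: x_def excess_def)
    qed
    then have "(\<Sum>j<k. 1) \<le> (\<Sum>j<k. x (length p + j))" by (intro sum_mono) simp
    also have "\<dots> = sum x ((\<lambda>j. length p + j) ` {..<k})"
      by (subst sum.reindex) auto
    also have "\<dots> \<le> (\<Sum>i\<le>length (?w @ v). x i)"
      using excess_nonneg[OF ctx vec] by (intro sum_mono2) (auto simp: x_def simp del: take_append)
    also have "\<dots> \<le> 2 * B * (16 * B + 2)\<^sup>2"
      unfolding x_def using almost_geodesic_excess[OF ctx vec v(1)[unfolded a]] v(2) by simp
    finally show ?thesis by simp
  qed
  obtain k :: nat where "2 * B * (16 * B + 2)\<^sup>2 < real k" using reals_Archimedean2 by blast
  then show False using bound[of k] by simp
qed

text \<open>Passing to a power of \<open>g\<close> makes the level as large as one likes, unless it vanishes.\<close>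

lemma stabilizer_busemann_direction:
  assumes u: "u \<in> sphere 0 1" and \<gamma>: "cartan_ray u \<gamma>"
    and g: "g \<in> stabilizer Cartan (reduced_action Cartan)
      (horo_class Cartan cartan_gens (busemann Cartan cartan_gens \<gamma>))" (is "g \<in> ?T")
  shows "\<exists>t. cartan_ab g = t *\<^sub>R u"
proof (rule sphere_cross2_eq_0[OF u], rule ccontr)
  interpret group Cartan by (rule group_Cartan)
  assume "cross2 u (cartan_ab g) \<noteq> 0"
  then obtain n :: nat where "3 < real n * \<bar>cross2 u (cartan_ab g)\<bar>"
    using reals_Archimedean3[of "\<bar>cross2 u (cartan_ab g)\<bar>"] by auto
  moreover have "subgroup ?T Cartan"
    by (rule subgroup_stabilizer_reduced_action[of _ cartan_gens]) (auto simp: horo_class_def bounded_diff_def)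
  then have "g [^]\<^bsub>Cartan\<^esub> n \<in> ?T"
    using subgroup_int_pow_closed[of ?T g "int n"] g by (simp add: int_pow_int)
  from stabilizer_busemann_level[OF u \<gamma> this]
  have "real n * \<bar>cross2 u (cartan_ab g)\<bar> < 3"
    using g by (simp add: cartan_ab_pow stabilizer_def abs_mult)
  ultimately show False by simp
qed

section \<open>Elements with prescribed direction\<close>

lemma subgroup_cartan_ab_direction: "subgroup {g \<in> carrier Cartan. \<exists>t. cartan_ab g = t *\<^sub>R u} Cartan"
proof -
  interpret group Cartan by (rule group_Cartan)
  show ?thesis
  proof
    show "{g \<in> carrier Cartan. \<exists>t. cartan_ab g = t *\<^sub>R u} \<subseteq> carrier Cartan" by auto
    show "\<one>\<^bsub>Cartan\<^esub> \<in> {g \<in> carrier Cartan. \<exists>t. cartan_ab g = t *\<^sub>R u}"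
      using cartan_ab_one by (auto intro: exI[of _ 0])
    show "g \<otimes>\<^bsub>Cartan\<^esub> h \<in> {g \<in> carrier Cartan. \<exists>t. cartan_ab g = t *\<^sub>R u}"
      if "g \<in> {g \<in> carrier Cartan. \<exists>t. cartan_ab g = t *\<^sub>R u}"
        "h \<in> {g \<in> carrier Cartan. \<exists>t. cartan_ab g = t *\<^sub>R u}" for g h
      using that by (auto simp: cartan_ab_mult simp flip: scaleR_left_distrib)
    show "inv\<^bsub>Cartan\<^esub> g \<in> {g \<in> carrier Cartan. \<exists>t. cartan_ab g = t *\<^sub>R u}"
      if "g \<in> {g \<in> carrier Cartan. \<exists>t. cartan_ab g = t *\<^sub>R u}" for g
      using that by (auto simp: cartan_ab_inv simp flip: scaleR_minus_left)
  qed
qed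

text \<open>In the commutative quotient by the derived subgroup every element takes the form of a
  power of x times a power of y, with its image in the plane as exponents; a zero image thus gives
  the trivial coset.\<close>

lemma derived_Cartan_eq: "derived Cartan (carrier Cartan) = {g \<in> carrier Cartan. cartan_ab g = 0}"
proof
  interpret group Cartan by (rule group_Cartan)
  \<comment> \<open>The kernel is the direction subgroup of the zero vector.\<close>
  have "subgroup {g \<in> carrier Cartan. cartan_ab g = 0} Cartan"
    using subgroup_cartan_ab_direction[of 0] by simp
  then show "derived Cartan (carrier Cartan) \<subseteq> {g \<in> carrier Cartan. cartan_ab g = 0}"
    unfolding derived_def
    by (intro generate_subgroup_incl) (auto simp: cartan_ab_mult cartan_ab_inv)
  let ?D = "derived Cartan (carrier Cartan)"
  interpret D: normal ?D Cartan by (rule derived_is_normal[OF normal_self])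
  define Q where "Q = Cartan Mod ?D"
  interpret Q: comm_group Q unfolding Q_def by (rule derived_quot_is_comm_group)
  interpret hom: group_hom Cartan Q "\<lambda>g. ?D #>\<^bsub>Cartan\<^esub> g"
    unfolding Q_def by (intro group_hom.intro group_hom_axioms.intro group_Cartan D.r_coset_hom_Mod
        Q.group_axioms[unfolded Q_def])
  define f where "f w = ?D #>\<^bsub>Cartan\<^esub> word_elt w" for w
  have f: "f w \<in> carrier Q" for w by (simp add: f_def hom.hom_closed)
  let ?x = "f [(GX, True)]" and ?y = "f [(GY, True)]"
  have inv: "f [inv_letter a] = inv\<^bsub>Q\<^esub> f [a]" for a
    unfolding f_def word_elt_inv_letter by (rule hom.hom_inv) simp
  have "\<exists>i j. f w = ?x [^]\<^bsub>Q\<^esub> (i :: int) \<otimes>\<^bsub>Q\<^esub> ?y [^]\<^bsub>Q\<^esub> (j :: int)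
    \<and> word_vec w = (of_int i, of_int j)" for w
  proof (induction w)
    case Nil
    have "f [] = \<one>\<^bsub>Q\<^esub>" by (simp add: f_def word_elt_Nil hom.hom_one)
    then show ?case by (intro exI[of _ 0]) (simp add: zero_prod_def)
  next
    case (Cons a w)
    then obtain i j :: int where ij: "f w = ?x [^]\<^bsub>Q\<^esub> i \<otimes>\<^bsub>Q\<^esub> ?y [^]\<^bsub>Q\<^esub> j"
      "word_vec w = (of_int i, of_int j)" by blast
    have fa: "f (a # w) = f [a] \<otimes>\<^bsub>Q\<^esub> f w"
      using word_elt_append[of "[a]" w] by (simp add: f_def hom.hom_mult)
    show ?case
    proof (cases a rule: letter_vec.cases)
      case (1 s)
      have "f [a] = ?x [^]\<^bsub>Q\<^esub> (if s then 1 else - 1 :: int)"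
        using inv[of "(GX, True)"] f 1 by (auto simp: inv_letter_def Q.int_pow_neg)
      then have "f (a # w) = ?x [^]\<^bsub>Q\<^esub> ((if s then 1 else - 1) + i) \<otimes>\<^bsub>Q\<^esub> ?y [^]\<^bsub>Q\<^esub> j"
        unfolding fa ij(1) using f by (simp add: Q.int_pow_mult Q.m_assoc)
      then show ?thesis using ij(2) 1 by (intro exI[of _ "(if s then 1 else - 1) + i"] exI[of _ j]) simp
    next
      case (2 s)
      have "f [a] = ?y [^]\<^bsub>Q\<^esub> (if s then 1 else - 1 :: int)"
        using inv[of "(GY, True)"] f 2 by (auto simp: inv_letter_def Q.int_pow_neg)
      then have "f (a # w) = ?x [^]\<^bsub>Q\<^esub> i \<otimes>\<^bsub>Q\<^esub> ?y [^]\<^bsub>Q\<^esub> ((if s then 1 else - 1) + j)"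
        unfolding fa ij(1) using f by (simp add: Q.int_pow_mult Q.m_lcomm)
      then show ?thesis using ij(2) 2 by (intro exI[of _ i] exI[of _ "(if s then 1 else - 1) + j"]) simp
    qed
  qed
  note normal_form = this
  show "{g \<in> carrier Cartan. cartan_ab g = 0} \<subseteq> ?D"
  proof safe
    fix g assume g: "g \<in> carrier Cartan" "cartan_ab g = 0"
    obtain w where w: "g = word_elt w" using g(1) by (rule word_elt_surj)
    have "word_vec w = 0" using g(2) by (simp add: w cartan_ab_word_elt)
    then have "f w = \<one>\<^bsub>Q\<^esub>" using normal_form[of w] by (auto simp: zero_prod_def)
    then have "?D #>\<^bsub>Cartan\<^esub> g = ?D" by (simp add: f_def w Q_def FactGroup_def)
    then show "g \<in> ?D" using g(1) D.subgroup_axioms by (rule coset_join1)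
  qed
qed

text \<open>Images in the plane have integer coordinates, so a nonzero multiple of \<open>u\<close>
  among them would make the slope a quotient of integers.\<close>

lemma irrational_direction_eq_derived:
  assumes "fst u \<noteq> 0" "snd u / fst u \<notin> \<rat>"
  shows "{g \<in> carrier Cartan. \<exists>t. cartan_ab g = t *\<^sub>R u} = derived Cartan (carrier Cartan)"
proof -
  have "cartan_ab g = 0" if g: "g \<in> carrier Cartan" "cartan_ab g = t *\<^sub>R u" for g t
  proof -
    obtain w where w: "g = word_elt w" using g(1) by (rule word_elt_surj)
    obtain i j where ij: "word_vec w = (of_int i, of_int j)" by (rule word_vec_int)
    have t: "of_int i = t * fst u" "of_int j = t * snd u"
      using g(2) ij by (simp_all add: w cartan_ab_word_elt prod_eq_iff)
    have "t = 0"
    proof (rule ccontr)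
      assume "t \<noteq> 0"
      then have "snd u / fst u = of_int j / of_int i" using t by simp
      then show False using assms(2) by simp
    qed
    then show ?thesis using g(2) by simp
  qed
  then show ?thesis unfolding derived_Cartan_eq by (auto intro: exI[of _ 0])
qed

theorem theorem3p7:
  fixes \<gamma> :: "real \<times> real \<Rightarrow> nat \<Rightarrow> cartan"
  assumes "\<And>u. u \<in> sphere 0 1 \<Longrightarrow> cartan_ray u (\<gamma> u)"
  shows "(\<forall>u \<in> sphere 0 1.
            horo_class Cartan cartan_gens (busemann Cartan cartan_gens (\<gamma> u))
              \<in> reduced_horoboundary Cartan cartan_gens) \<and>
         inj_on (\<lambda>u. horo_class Cartan cartan_gens (busemann Cartan cartan_gens (\<gamma> u)))
           (sphere 0 1) \<and>
         (\<forall>u \<in> sphere 0 1.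
            subgroup
              (stabilizer Cartan (reduced_action Cartan)
                (horo_class Cartan cartan_gens (busemann Cartan cartan_gens (\<gamma> u))))
              (Cartan\<lparr>carrier := {g \<in> carrier Cartan. \<exists>t. cartan_ab g = t *\<^sub>R u}\<rparr>)) \<and>
         (\<forall>u \<in> sphere 0 1. fst u \<noteq> 0 \<and> snd u / fst u \<notin> \<rat> \<longrightarrow>
            {g \<in> carrier Cartan. \<exists>t. cartan_ab g = t *\<^sub>R u} = derived Cartan (carrier Cartan))"
proof (intro conjI ballI impI)
  note ray = assms
  interpret group Cartan by (rule group_Cartan)
  let ?b = "\<lambda>u. busemann Cartan cartan_gens (\<gamma> u)"
  have b: "?b u \<in> horoboundary Cartan cartan_gens" if "u \<in> sphere 0 1" for u
    by (rule geodesic_ray.busemann_in_horoboundary[OF geodesic_cartan_ray[OF that ray[OF that]]])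
  show "horo_class Cartan cartan_gens (?b u) \<in> reduced_horoboundary Cartan cartan_gens"
    if "u \<in> sphere 0 1" for u
    unfolding reduced_horoboundary_def horo_class_def using b[OF that] by (rule quotientI)
  show "inj_on (\<lambda>u. horo_class Cartan cartan_gens (?b u)) (sphere 0 1)"
  proof (rule inj_onI)
    fix u u' :: "real \<times> real"
    assume u: "u \<in> sphere 0 1" "u' \<in> sphere 0 1"
      and "horo_class Cartan cartan_gens (?b u) = horo_class Cartan cartan_gens (?b u')"
    then obtain K where "\<forall>h\<in>carrier Cartan. \<bar>?b u h - ?b u' h\<bar> \<le> K"
      using horo_class_eqD[OF b b] by blast
    then show "u = u'"
      by (intro busemann_bounded_diff_eq[OF u(1) ray[OF u(1)] u(2) ray[OF u(2)]]) blast
  qed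
  show "subgroup (stabilizer Cartan (reduced_action Cartan) (horo_class Cartan cartan_gens (?b u)))
      (Cartan\<lparr>carrier := {g \<in> carrier Cartan. \<exists>t. cartan_ab g = t *\<^sub>R u}\<rparr>)"
    if u: "u \<in> sphere 0 1" for u
  proof (rule subgroup_incl[OF _ subgroup_cartan_ab_direction])
    show "subgroup (stabilizer Cartan (reduced_action Cartan) (horo_class Cartan cartan_gens (?b u))) Cartan"
      by (rule subgroup_stabilizer_reduced_action[of _ cartan_gens])
        (auto simp: horo_class_def bounded_diff_def)
    show "stabilizer Cartan (reduced_action Cartan) (horo_class Cartan cartan_gens (?b u))
        \<subseteq> {g \<in> carrier Cartan. \<exists>t. cartan_ab g = t *\<^sub>R u}"
      using stabilizer_busemann_direction[OF u ray[OF u]] by (auto simp: stabilizer_def)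
  qed
  show "{g \<in> carrier Cartan. \<exists>t. cartan_ab g = t *\<^sub>R u} = derived Cartan (carrier Cartan)"
    if "u \<in> sphere 0 1" "fst u \<noteq> 0 \<and> snd u / fst u \<notin> \<rat>" for u
    using irrational_direction_eq_derived that by blast
qed

end
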